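(* Let $\ell$ be a positive integer. If $\ell \in \{1, 2, 4, 5\}$, then there exists no cubic $\ell$-circulant nut graph. If $\ell \in \{3, 6, 7\}$ or $\ell \ge 9$, then there exist infinitely many (pairwise non-isomorphic) cubic $\ell$-circulant nut graphs.
   Context: A nut graph is a simple graph with at least two vertices whose adjacency matrix has a one-dimensional null space spanned by a vector with no zero entries. For a positive integer $\ell$, an $\ell$-circulant graph is a graph that admits a cyclic group of automorphisms having exactly $\ell$ vertex orbits, all of equal size. A cubic graph is a $3$-regular graph. *)

theory Defs
  imports
    "HOL-Library.Function_Algebras"
    "HOL-Algebra.Elementary_Groups"
    "HOL-Algebra.Group_Action"
    "Graph_Theory.Pair_Digraph"
    "Graph_Theory.Digraph_Isomorphism"
begin

text \<open>
  A finite simple graph is a \<^typ>\<open>'a pair_pre_digraph\<close> satisfying \<^const>\<open>pair_graph\<close>: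
  a finite loopless symmetric digraph without parallel arcs, where an edge between \<open>u\<close> and \<open>v\<close> is
  represented by the two arcs \<open>(u, v)\<close> and \<open>(v, u)\<close>.
\<close>

global_interpretation fun_vs: vector_space "\<lambda>(c::real) (x::'a \<Rightarrow> real) v. c * x v"
  by standard (auto simp: fun_eq_iff algebra_simps)

definition adjacency_matrix :: "'a pair_pre_digraph \<Rightarrow> 'a \<Rightarrow> 'a \<Rightarrow> real" where
  "adjacency_matrix G u v = (if (u, v) \<in> parcs G then 1 else 0)"

text \<open>
  A real vector indexed by the vertices is a function vanishing outside the vertex set.
\<close>

definition null_space :: "'a pair_pre_digraph \<Rightarrow> ('a \<Rightarrow> real) set" where
  "null_space G =
     {x. (\<forall>v. v \<notin> pverts G \<longrightarrow> x v = 0) \<and>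
         (\<forall>u\<in>pverts G. (\<Sum>v\<in>pverts G. adjacency_matrix G u v * x v) = 0)}"

definition nut_graph :: "'a pair_pre_digraph \<Rightarrow> bool" where
  "nut_graph G \<longleftrightarrow>
     pair_graph G \<and> card (pverts G) \<ge> 2 \<and>
     fun_vs.dim (null_space G) = 1 \<and>
     (\<exists>x. null_space G = fun_vs.span {x} \<and> (\<forall>v\<in>pverts G. x v \<noteq> 0))"

definition cubic :: "'a pair_pre_digraph \<Rightarrow> bool" where
  "cubic G \<longleftrightarrow> (\<forall>v\<in>pverts G. out_degree (with_proj G) v = 3)"

definition automorphisms :: "'a pair_pre_digraph \<Rightarrow> ('a \<Rightarrow> 'a) set" where
  "automorphisms G =
     {f \<in> Bij (pverts G). \<forall>u\<in>pverts G. \<forall>v\<in>pverts G. (f u, f v) \<in> parcs G \<longleftrightarrow> (u, v) \<in> parcs G}"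

definition automorphism_group :: "'a pair_pre_digraph \<Rightarrow> ('a \<Rightarrow> 'a) monoid" where
  "automorphism_group G = (BijGroup (pverts G))\<lparr>carrier := automorphisms G\<rparr>"

lemma subgroup_automorphisms: "subgroup (automorphisms G) (BijGroup (pverts G))"
proof (rule group.subgroupI[OF group_BijGroup])
  show "automorphisms G \<subseteq> carrier (BijGroup (pverts G))"
    by (auto simp: automorphisms_def BijGroup_def)
  have "(\<lambda>x\<in>pverts G. x) \<in> automorphisms G"
    by (auto simp: automorphisms_def id_Bij)
  then show "automorphisms G \<noteq> {}" by blast
next
  fix f assume f: "f \<in> automorphisms G"
  then have B: "f \<in> Bij (pverts G)" by (simp add: automorphisms_def)
  let ?g = "\<lambda>x\<in>pverts G. inv_into (pverts G) f x"
  have "?g \<in> automorphisms G"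
    unfolding automorphisms_def
  proof (intro CollectI conjI ballI)
    show "?g \<in> Bij (pverts G)" by (rule restrict_inv_into_Bij[OF B])
  next
    fix u v assume uv: "u \<in> pverts G" "v \<in> pverts G"
    let ?u = "inv_into (pverts G) f u" and ?v = "inv_into (pverts G) f v"
    have im: "f ` pverts G = pverts G" using B by (simp add: Bij_def bij_betw_def)
    have "f ?u = u" "f ?v = v" using uv im by (auto intro: f_inv_into_f)
    moreover have "?u \<in> pverts G" "?v \<in> pverts G"
      using uv B by (auto intro: Bij_inv_into_mem)
    ultimately have "(u, v) \<in> parcs G \<longleftrightarrow> (?u, ?v) \<in> parcs G"
      using f unfolding automorphisms_def by (metis (mono_tags, lifting) mem_Collect_eq)
    then show "(?g u, ?g v) \<in> parcs G \<longleftrightarrow> (u, v) \<in> parcs G"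
      using uv by simp
  qed
  then show "inv\<^bsub>BijGroup (pverts G)\<^esub> f \<in> automorphisms G" by (simp add: inv_BijGroup[OF B])
next
  fix f g assume fg: "f \<in> automorphisms G" "g \<in> automorphisms G"
  then have B: "f \<in> Bij (pverts G)" "g \<in> Bij (pverts G)" by (simp_all add: automorphisms_def)
  have "g u \<in> pverts G" if "u \<in> pverts G" for u
    using B(2) that by (auto dest: Bij_imp_funcset)
  then have "compose (pverts G) f g \<in> automorphisms G"
    using fg B by (auto simp: automorphisms_def compose_Bij compose_eq)
  then show "f \<otimes>\<^bsub>BijGroup (pverts G)\<^esub> g \<in> automorphisms G"
    using B by (simp add: BijGroup_def)
qed

lemma group_automorphism_group: "group (automorphism_group G)"
  unfolding automorphism_group_def
  by (rule group.subgroup_imp_group[OF group_BijGroup subgroup_automorphisms])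

definition circulant :: "nat \<Rightarrow> 'a pair_pre_digraph \<Rightarrow> bool" where
  "circulant l G \<longleftrightarrow>
     (\<exists>H. subgroup H (automorphism_group G) \<and>
          (let C = (automorphism_group G)\<lparr>carrier := H\<rparr>; orbs = orbits C (pverts G) (\<lambda>f. f)
           in cyclic_group C \<and> card orbs = l \<and> (\<forall>A\<in>orbs. \<forall>B\<in>orbs. card A = card B)))"

end

theory Submission
  imports Defs "HOL-Computational_Algebra.Polynomial"
begin

text \<open>
  Nonexistence. The nut vector \<open>x\<close> spans the null space, so every automorphism maps it to \<open>x\<close> or
  \<open>- x\<close>; hence its absolute value is constant on orbits. Summing the signs of \<open>x\<close> along the edges
  between two orbits gives a symmetric integer matrix (the orbits have equal size) whose rows have
  absolute sum 1 or 3, and which annihilates the positive vector of absolute values. Ordering the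
  orbits by these values, a finite search shows that no such matrix of order 1, 2, 4 or 5 exists.

  Existence. By the discrete Fourier transform, a graph given by voltages modulo \<open>n = 2 * m\<close> is a
  nut graph if the voltage matrix is nonsingular at every \<open>n\<close>-th root of unity \<open>z\<close> but one, which is
  \<open>1\<close> or \<open>- 1\<close> and has a one-dimensional kernel spanned by a vector without zeros. Three orbits with
  semi-edges inserted in a path multiply the transfer by \<open>s = z ^ m\<close>, a sign, so it is enough to have
  examples with 3, 7 and 11 orbits. With \<open>c = z ^ 2 + z ^ (- 2)\<close>, the determinant of the first
  vanishes iff \<open>c = 2 * s\<close>, and that of the other two iff \<open>(2 * c - s) * (c + 2 * s) = 0\<close>.
\<close>

section \<open>Signed quotient matrices\<close>

text \<open>
  All partial sums are nonnegative and the total is positive, where \<open>a\<close> is the sum accumulated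
  so far. By Abel summation such a vector pairs positively with every positive nonincreasing vector.
\<close>

fun dominant :: "int \<Rightarrow> int list \<Rightarrow> bool" where
  "dominant a [] = (0 < a)"
| "dominant a (b # v) = (if a + b < 0 then False else dominant (a + b) v)"

text \<open>The sign test in both directions: a row that passes it cannot annihilate a positive
  nonincreasing vector.\<close>

definition definite :: "int list \<Rightarrow> bool" where
  "definite v = (if dominant 0 v then True else dominant 0 (map uminus v))"

text \<open>The integer vectors of length \<open>l\<close> and l1-norm exactly \<open>s\<close>. As
  \<open>a\<close> stays between \<open>- s\<close> and \<open>s\<close>, the natural subtraction
  never truncates.\<close>

fun signed_rows :: "nat \<Rightarrow> nat \<Rightarrow> int list list" where
  "signed_rows 0 s = (if s = 0 then [[]] else [])"
| "signed_rows (Suc l) s =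
     concat (map (\<lambda>a. map ((#) a) (signed_rows l (s - nat \<bar>a\<bar>))) [- int s..int s])"

text \<open>Three signs per vertex leave an odd absolute row sum of at most 3, hence the norms 1 and
  3.\<close>

definition indefinite_rows :: "nat \<Rightarrow> int list list" where
  "indefinite_rows l = filter (\<lambda>v. \<not> definite v) (signed_rows l 1 @ signed_rows l 3)"

text \<open>
  Each candidate row \<open>r\<close> is stored together with the part \<open>t\<close> of it that lies on and right of the
  current column; choosing a row fixes the current column of all later ones.
\<close>

definition select_head :: "int \<Rightarrow> (int list \<times> int list) list \<Rightarrow> (int list \<times> int list) list" where
  "select_head e C = map (\<lambda>(r, t). (r, tl t)) (filter (\<lambda>(r, t). hd t = e) C)"

function symmetric_choices :: "(int list \<times> int list) list list \<Rightarrow> int list list list" where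
  "symmetric_choices [] = [[]]"
| "symmetric_choices (C # Cs) =
     concat (map (\<lambda>(r, t). map ((#) r) (symmetric_choices (map2 select_head (tl t) Cs))) C)"
  by pat_completeness auto
termination by (relation "measure length") auto

text \<open>\<open>zip\<close> truncates, so one list of certificates serves every order: absent
  coefficients count as 0 and surplus ones are ignored.\<close>

definition combination :: "int list \<Rightarrow> int list list \<Rightarrow> nat \<Rightarrow> int list" where
  "combination cs rs l = foldr (\<lambda>(c, r). map2 (+) (map ((*) c) r)) (zip cs rs) (replicate l 0)"

text \<open>
  Coefficient vectors found by computer (a greedy cover): in every symmetric candidate matrix of
  order 4 or 5, one of these combinations of the rows is definite.
\<close>

definition certificates :: "int list list" where
  "certificates = [[2, 1, 1, 1], [3, 2, 2, 1, 1], [1, 1, 0, 1], [0, 0, 1, 1, - 1]]"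

definition refuted :: "nat \<Rightarrow> bool" where
  "refuted l \<longleftrightarrow> list_all (\<lambda>rs. list_ex (\<lambda>cs. definite (combination cs rs l)) certificates)
     (symmetric_choices (replicate l (map (\<lambda>r. (r, r)) (indefinite_rows l))))"

text \<open>For orders 1 and 2 no symmetric matrix of indefinite rows exists at all; for orders 4
  and 5 the certificates dispose of those that remain.\<close>

lemma refuted: "refuted 1" "refuted 2" "refuted 4" "refuted 5"
  by code_simp+

section \<open>Pairing rows with a positive nonincreasing vector\<close>

definition pairing :: "int list \<Rightarrow> real list \<Rightarrow> real" where
  "pairing v ys = sum_list (map2 (\<lambda>a y. of_int a * y) v ys)"

lemma pairing_simps [simp]:
  "pairing [] ys = 0"
  "pairing (a # v) (y # ys) = of_int a * y + pairing v ys"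
  by (simp_all add: pairing_def)

lemma pairing_add:
  "length r = length v \<Longrightarrow> length v = length ys \<Longrightarrow> pairing (map2 (+) r v) ys = pairing r ys + pairing v ys"
  by (induction r v ys rule: list_induct3) (auto simp: algebra_simps)

lemma pairing_scale: "length v = length ys \<Longrightarrow> pairing (map ((*) c) v) ys = of_int c * pairing v ys"
  by (induction v ys rule: list_induct2) (auto simp: algebra_simps)

lemma pairing_uminus: "length v = length ys \<Longrightarrow> pairing (map uminus v) ys = - pairing v ys"
  by (induction v ys rule: list_induct2) auto

lemma pairing_replicate_0: "pairing (replicate (length ys) 0) ys = 0"
  by (induction ys) auto

lemma pairing_map_upt: "pairing (map f [0..<l]) (map y [0..<l]) = (\<Sum>j<l. of_int (f j) * y j)"
  by (simp add: pairing_def zip_map1 zip_map2 zip_same_conv_map o_def atLeast0LessThan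
      interv_sum_list_conv_sum_set_nat)

text \<open>Abel summation as an induction: the accumulated sum \<open>a\<close> is weighted by
  \<open>y\<close>, the weight just before the list. Moving it to the next, smaller weight can only
  lower the total because \<open>a\<close> is nonnegative.\<close>

lemma dominant_pairing_pos:
  assumes "length v = length ys" "dominant a v" "0 \<le> a"
    "sorted_wrt (\<ge>) (y # ys)" "\<forall>x\<in>set (y # ys). 0 < x"
  shows "0 < of_int a * y + pairing v ys"
  using assms
proof (induction v ys arbitrary: a y rule: list_induct2)
  case (Cons b v x ys)
  from Cons.prems have "0 \<le> a + b" "dominant (a + b) v" by (auto split: if_splits)
  then have "0 < of_int (a + b) * x + pairing v ys"
    using Cons.prems by (intro Cons.IH) auto
  moreover have "of_int a * x \<le> of_int a * y" using Cons.prems by (intro mult_left_mono) auto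
  ultimately show ?case by (simp add: algebra_simps)
qed auto

lemma pairing_definite_nonzero:
  assumes len: "length v = length ys" and "definite v"
    and ys: "sorted_wrt (\<ge>) ys" "\<forall>x\<in>set ys. 0 < x"
  shows "pairing v ys \<noteq> 0"
proof -
  have *: "0 < pairing w ys" if "length w = length ys" "dominant 0 w" for w
  proof (cases ys)
    case Nil
    then show ?thesis using that by simp
  next
    case (Cons y ys')
    \<comment> \<open>With accumulated sum 0 the preceding weight is arbitrary, so the head of
      \<open>ys\<close> is simply repeated.\<close>
    have "sorted_wrt (\<ge>) (y # ys)" "\<forall>x\<in>set (y # ys). 0 < x"
      using ys unfolding Cons by auto
    from dominant_pairing_pos[OF that(1,2) _ this] show ?thesis by simp
  qed
  show ?thesis
    using *[of v] *[of "map uminus v"] assms(1,2)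
    by (auto simp: definite_def pairing_uminus split: if_splits)
qed

lemma in_signed_rows: "v \<in> set (signed_rows (length v) (\<Sum>a\<leftarrow>v. nat \<bar>a\<bar>))"
proof (induction v)
  case (Cons a v)
  let ?s = "\<Sum>a\<leftarrow>a # v. nat \<bar>a\<bar>"
  have "int ?s = \<bar>a\<bar> + int (\<Sum>a\<leftarrow>v. nat \<bar>a\<bar>)" by simp
  then have a: "a \<in> {- int ?s..int ?s}" unfolding atLeastAtMost_iff by linarith
  have "v \<in> set (signed_rows (length v) (?s - nat \<bar>a\<bar>))" using Cons.IH by simp
  then have "a # v \<in> set (map ((#) a) (signed_rows (length v) (?s - nat \<bar>a\<bar>)))" by simp
  with a show ?case
    unfolding length_Cons signed_rows.simps set_concat set_map set_upto image_image by (rule UN_I[of a])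
qed simp

text \<open>Completeness of the search. The unread parts \<open>snd\<close> form a symmetric square
  matrix, and removing its first row and column keeps it so. By symmetry the head of every later
  part is the entry of the chosen row that \<open>select_head\<close> asks for.\<close>

lemma in_symmetric_choices:
  assumes "list_all2 (\<lambda>x C. x \<in> set C) xs Cs"
    and "\<And>i. i < length xs \<Longrightarrow> length (snd (xs ! i)) = length xs"
    and "\<And>i j. i < length xs \<Longrightarrow> j < length xs \<Longrightarrow> snd (xs ! i) ! j = snd (xs ! j) ! i"
  shows "map fst xs \<in> set (symmetric_choices Cs)"
  using assms
proof (induction "length xs" arbitrary: xs Cs)
  case (Suc k)
  obtain r t xs' where xs: "xs = (r, t) # xs'" using Suc.hyps(2) by (cases xs) auto
  obtain C Cs' where Cs: "Cs = C # Cs'" using Suc.prems(1) xs by (cases Cs) auto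
  have len: "length t = Suc k" "length xs' = k" "length Cs' = k"
    using Suc.prems(2)[of 0] Suc.hyps(2) list_all2_lengthD[OF Suc.prems(1)] by (simp_all add: xs Cs)
  have lent: "length (snd (xs' ! i)) = Suc k" if "i < k" for i
    using Suc.prems(2)[of "Suc i"] that len by (simp add: xs)
  have mem: "xs' ! i \<in> set (Cs' ! i)" if "i < k" for i
    using list_all2_nthD[OF Suc.prems(1), of "Suc i"] that len by (simp add: xs Cs)
  let ?ys = "map (\<lambda>(r, t). (r, tl t)) xs'" and ?Cs = "map2 select_head (tl t) Cs'"
  have "map fst ?ys \<in> set (symmetric_choices ?Cs)"
  proof (rule Suc.hyps(1))
    show "k = length ?ys" using len by simp
    show "list_all2 (\<lambda>x C. x \<in> set C) ?ys ?Cs"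
    proof (rule list_all2_all_nthI)
      show "length ?ys = length ?Cs" using len by simp
      fix i assume i: "i < length ?ys"
      then have ik: "i < k" using len by simp
      have "snd (xs' ! i) \<noteq> []" using lent[OF ik] by auto
      then have "hd (snd (xs' ! i)) = tl t ! i"
        using Suc.prems(3)[of 0 "Suc i"] ik len by (simp add: xs nth_tl hd_conv_nth)
      then show "?ys ! i \<in> set (?Cs ! i)"
        using ik len mem[OF ik] by (force simp: select_head_def split_beta)
    qed
    show "length (snd (?ys ! i)) = length ?ys" if "i < length ?ys" for i
      using that lent[of i] len by (simp add: split_beta)
    show "snd (?ys ! i) ! j = snd (?ys ! j) ! i" if "i < length ?ys" "j < length ?ys" for i j
      using that Suc.prems(3)[of "Suc i" "Suc j"] lent[of i] lent[of j] len
      by (simp add: split_beta xs nth_tl)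
  qed
  moreover have "map fst ?ys = map fst xs'" by (simp add: split_beta)
  ultimately have "map fst xs' \<in> set (symmetric_choices ?Cs)" by (simp only:)
  moreover have "(r, t) \<in> set C" using Suc.prems(1) by (simp add: xs Cs)
  ultimately show ?case by (force simp: xs Cs)
qed simp

lemma combination_pairing:
  assumes "\<And>r. r \<in> set rs \<Longrightarrow> length r = length ys \<and> pairing r ys = 0"
  shows "length (combination cs rs (length ys)) = length ys \<and> pairing (combination cs rs (length ys)) ys = 0"
  using assms
proof (induction cs arbitrary: rs)
  case Nil
  then show ?case by (simp add: combination_def pairing_replicate_0)
next
  case (Cons c cs)
  show ?case
  proof (cases rs)
    case Nil
    then show ?thesis by (simp add: combination_def pairing_replicate_0)
  next
    case (Cons r rs')
    have *: "length (combination cs rs' (length ys)) = length ys" "pairing (combination cs rs' (length ys)) ys = 0"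
      using Cons.IH[of rs'] Cons.prems Cons by auto
    have "combination (c # cs) rs (length ys) = map2 (+) (map ((*) c) r) (combination cs rs' (length ys))"
      by (simp add: combination_def Cons)
    then show ?thesis using * Cons.prems[of r] Cons by (simp add: pairing_add pairing_scale)
  qed
qed

text \<open>Every row annihilates \<open>y\<close>, so it is indefinite and the search meets the
  matrix. The certificate then yields a definite combination of rows, which also annihilates
  \<open>y\<close>; this is impossible.\<close>

proposition refuted_imp_no_positive_kernel:
  fixes M :: "nat \<Rightarrow> nat \<Rightarrow> int" and y :: "nat \<Rightarrow> real"
  assumes "refuted l"
    and sym: "\<And>i j. i < l \<Longrightarrow> j < l \<Longrightarrow> M i j = M j i"
    and abs_sum: "\<And>i. i < l \<Longrightarrow> (\<Sum>j<l. \<bar>M i j\<bar>) \<in> {1, 3}"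
    and ker: "\<And>i. i < l \<Longrightarrow> (\<Sum>j<l. of_int (M i j) * y j) = 0"
    and pos: "\<And>i. i < l \<Longrightarrow> 0 < y i"
    and desc: "\<And>i j. i < j \<Longrightarrow> j < l \<Longrightarrow> y j \<le> y i"
  shows False
proof -
  define ys where "ys = map y [0..<l]"
  define row where "row i = map (M i) [0..<l]" for i
  have ys: "sorted_wrt (\<ge>) ys" "\<forall>x\<in>set ys. 0 < x"
    using pos desc by (auto simp: ys_def sorted_wrt_iff_nth_less)
  have len: "length ys = l" "length (row i) = l" for i by (simp_all add: ys_def row_def)
  have zero: "pairing (row i) ys = 0" if "i < l" for i
    using ker[OF that] by (simp add: row_def ys_def pairing_map_upt)
  have row: "row i \<in> set (indefinite_rows l)" if "i < l" for i
  proof -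
    have "int (\<Sum>a\<leftarrow>row i. nat \<bar>a\<bar>) = (\<Sum>j<l. \<bar>M i j\<bar>)"
      by (simp add: row_def o_def atLeast0LessThan interv_sum_list_conv_sum_set_nat)
    then have "(\<Sum>a\<leftarrow>row i. nat \<bar>a\<bar>) \<in> {1, 3}"
      using abs_sum[OF that] by auto
    then have "row i \<in> set (signed_rows l 1 @ signed_rows l 3)"
      using in_signed_rows[of "row i"] len by auto
    moreover have "\<not> definite (row i)"
      using pairing_definite_nonzero[OF _ _ ys, of "row i"] zero[OF that] len by auto
    ultimately show ?thesis by (simp add: indefinite_rows_def)
  qed
  let ?xs = "map (\<lambda>i. (row i, row i)) [0..<l]"
  have "map fst ?xs \<in> set (symmetric_choices (replicate l (map (\<lambda>r. (r, r)) (indefinite_rows l))))"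
    by (rule in_symmetric_choices) (auto simp: list_all2_conv_all_nth row len, auto simp: row_def sym)
  then have "list_ex (\<lambda>cs. definite (combination cs (map row [0..<l]) l)) certificates"
    using \<open>refuted l\<close> by (auto simp: refuted_def list_all_iff o_def)
  then obtain cs where "definite (combination cs (map row [0..<l]) l)" by (auto simp: list_ex_iff)
  moreover have "length (combination cs (map row [0..<l]) (length ys)) = length ys \<and>
      pairing (combination cs (map row [0..<l]) (length ys)) ys = 0"
    by (rule combination_pairing) (auto simp: len zero)
  ultimately show False using pairing_definite_nonzero[OF _ _ ys] len by auto
qed

section \<open>The nut vector and the signed quotient by orbits\<close>

lemma sum_adjacency_matrix:
  assumes "finite (pverts G)" "u \<in> pverts G"
  shows "(\<Sum>v\<in>pverts G. adjacency_matrix G u v * x v) = (\<Sum>v\<in>{v \<in> pverts G. (u, v) \<in> parcs G}. x v)"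
  using assms by (auto simp: adjacency_matrix_def intro!: sum.mono_neutral_cong_right split: if_splits)

text \<open>An automorphism permutes neighbourhoods, so reindexing turns the equation at
  \<open>u\<close> into the equation at \<open>f u\<close>. The conditional keeps the vector zero
  outside the vertex set.\<close>

lemma automorphism_null_vector:
  assumes f: "f \<in> automorphisms G" and x: "x \<in> null_space G"
  shows "(\<lambda>v. if v \<in> pverts G then x (f v) else 0) \<in> null_space G"
  unfolding null_space_def
proof (intro CollectI conjI ballI allI impI)
  let ?V = "pverts G"
  fix u assume u: "u \<in> ?V"
  have bij: "bij_betw f ?V ?V" using f by (auto simp: automorphisms_def Bij_def)
  then have fu: "f u \<in> ?V" using u by (auto simp: bij_betw_def)
  have "(\<Sum>v\<in>?V. adjacency_matrix G u v * (if v \<in> ?V then x (f v) else 0)) =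
      (\<Sum>v\<in>?V. adjacency_matrix G (f u) (f v) * x (f v))"
    using f u by (intro sum.cong) (auto simp: automorphisms_def adjacency_matrix_def)
  also have "\<dots> = (\<Sum>v\<in>?V. adjacency_matrix G (f u) v * x v)"
    using bij by (rule sum.reindex_bij_betw)
  also have "\<dots> = 0" using x fu by (auto simp: null_space_def)
  finally show "(\<Sum>v\<in>?V. adjacency_matrix G u v * (if v \<in> ?V then x (f v) else 0)) = 0" .
qed auto

text \<open>A one-dimensional null space makes the permuted vector a multiple of \<open>x\<close>;
  permuting coordinates preserves the sum of squares, so the factor squares to 1.\<close>

lemma automorphism_nut_vector_sign:
  assumes fin: "finite (pverts G)" and ne: "pverts G \<noteq> {}"
    and span: "null_space G = fun_vs.span {x}" and nz: "\<And>v. v \<in> pverts G \<Longrightarrow> x v \<noteq> 0"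
    and f: "f \<in> automorphisms G"
  obtains c :: real where "c = 1 \<or> c = - 1" "\<And>v. v \<in> pverts G \<Longrightarrow> x (f v) = c * x v"
proof -
  let ?V = "pverts G"
  have "x \<in> null_space G" unfolding span by (rule fun_vs.span_base) simp
  from automorphism_null_vector[OF f this]
  obtain c where "(\<lambda>v. if v \<in> ?V then x (f v) else 0) = (\<lambda>v. c * x v)"
    unfolding span fun_vs.span_singleton by auto
  then have c: "x (f v) = c * x v" if "v \<in> ?V" for v using that by (auto simp: fun_eq_iff split: if_splits)
  have bij: "bij_betw f ?V ?V" using f by (auto simp: automorphisms_def Bij_def)
  have "(\<Sum>v\<in>?V. (x v)\<^sup>2) = (\<Sum>v\<in>?V. (x (f v))\<^sup>2)" by (rule sum.reindex_bij_betw[OF bij, symmetric])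
  also have "\<dots> = c\<^sup>2 * (\<Sum>v\<in>?V. (x v)\<^sup>2)"
    unfolding sum_distrib_left by (intro sum.cong) (auto simp: c power_mult_distrib)
  finally have "(c\<^sup>2 - 1) * (\<Sum>v\<in>?V. (x v)\<^sup>2) = 0" by (simp add: algebra_simps)
  moreover have "0 < (\<Sum>v\<in>?V. (x v)\<^sup>2)" using fin ne nz by (intro sum_pos) auto
  ultimately have "c\<^sup>2 = 1" by simp
  then show ?thesis using that[of c] c by (auto simp: power2_eq_1_iff)
qed

text \<open>Applied to the neighbours of a vertex inside one orbit, this bounds an entry of the
  quotient matrix and fixes its parity.\<close>

lemma sum_signs_bounds:
  fixes g :: "'a \<Rightarrow> int"
  assumes "finite A" "\<And>a. a \<in> A \<Longrightarrow> g a = 1 \<or> g a = - 1"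
  shows "\<bar>sum g A\<bar> \<le> int (card A)" "even (\<bar>sum g A\<bar> + int (card A))"
proof -
  have "\<bar>sum g A\<bar> \<le> (\<Sum>a\<in>A. \<bar>g a\<bar>)" by (rule sum_abs)
  also have "\<dots> = (\<Sum>a\<in>A. 1)" using assms(2) by (intro sum.cong) fastforce+
  finally show "\<bar>sum g A\<bar> \<le> int (card A)" by simp
  have "even (sum g A + int (card A))" using assms
  proof (induction A rule: finite_induct)
    case (insert a A)
    then have "g a = 1 \<or> g a = - 1" "even (sum g A + int (card A))" by auto
    then show ?case using insert.hyps by (elim disjE) auto
  qed simp
  then show "even (\<bar>sum g A\<bar> + int (card A))" by simp
qed

text \<open>The quotient matrix is \<open>m (rep A) B\<close> and its positive kernel vector is
  \<open>Y\<close>; together they contradict \<open>refuted_imp_no_positive_kernel\<close>.\<close>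

lemma cubic_circulant_nut_not_refuted:
  assumes nut: "nut_graph G" and cub: "cubic G" and circ: "circulant l G"
  shows "\<not> refuted l"
proof
  assume ref: "refuted l"
  interpret pair_graph G using nut by (simp add: nut_graph_def)
  let ?V = "pverts G"
  obtain H where H: "subgroup H (automorphism_group G)"
    and orbs: "card (orbits ((automorphism_group G)\<lparr>carrier := H\<rparr>) ?V (\<lambda>f. f)) = l"
      "\<And>A B. A \<in> orbits ((automorphism_group G)\<lparr>carrier := H\<rparr>) ?V (\<lambda>f. f) \<Longrightarrow>
         B \<in> orbits ((automorphism_group G)\<lparr>carrier := H\<rparr>) ?V (\<lambda>f. f) \<Longrightarrow> card A = card B"
    using circ by (auto simp: circulant_def Let_def)
  define Orb where "Orb = orbits ((automorphism_group G)\<lparr>carrier := H\<rparr>) ?V (\<lambda>f. f)"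
  have Orb_eq: "Orb = (\<lambda>v. (\<lambda>f. f v) ` H) ` ?V"
    by (auto simp: Orb_def orbits_def orbit_def)
  obtain x where span: "null_space G = fun_vs.span {x}" and nz: "\<And>v. v \<in> ?V \<Longrightarrow> x v \<noteq> 0"
    using nut by (auto simp: nut_graph_def)
  have fin: "finite ?V" by (rule pair_finite_verts)
  have ne: "?V \<noteq> {}" using nut by (auto simp: nut_graph_def)
  have aut: "f \<in> automorphisms G" if "f \<in> H" for f
    using subgroup.subset[OF H] that by (auto simp: automorphism_group_def)
  have mapV: "f v \<in> ?V" if "f \<in> H" "v \<in> ?V" for f v
    using aut[OF that(1)] that(2) by (auto simp: automorphisms_def Bij_def bij_betw_def)
  have one: "(\<lambda>v\<in>?V. v) \<in> H"
    using subgroup.one_closed[OF H] by (simp add: automorphism_group_def BijGroup_def)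
  have comp: "compose ?V f g \<in> H" if "f \<in> H" "g \<in> H" for f g
    using subgroup.m_closed[OF H that] aut[OF that(1)] aut[OF that(2)]
    by (simp add: automorphism_group_def BijGroup_def automorphisms_def)
  have inverse: "\<exists>g\<in>H. \<forall>v\<in>?V. g (f v) = v" if f: "f \<in> H" for f
  proof -
    interpret A: group "automorphism_group G" by (rule group_automorphism_group)
    let ?g = "inv\<^bsub>automorphism_group G\<^esub> f"
    have g: "?g \<in> H" using subgroup.m_inv_closed[OF H f] .
    have "?g \<otimes>\<^bsub>automorphism_group G\<^esub> f = \<one>\<^bsub>automorphism_group G\<^esub>"
      using f subgroup.subset[OF H] by (intro A.l_inv) auto
    then have "compose ?V ?g f = (\<lambda>v\<in>?V. v)"
      using aut[OF f] aut[OF g] by (simp add: automorphism_group_def BijGroup_def automorphisms_def)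
    then have "?g (f v) = v" if "v \<in> ?V" for v
      using that by (metis compose_eq restrict_apply')
    then show ?thesis using g by blast
  qed
  have arc: "(f u, f v) \<in> parcs G \<longleftrightarrow> (u, v) \<in> parcs G" if "f \<in> H" "u \<in> ?V" "v \<in> ?V" for f u v
    using aut[OF that(1)] that(2,3) by (auto simp: automorphisms_def)
  define orb where "orb v = (\<lambda>f. f v) ` H" for v
  have orb_self: "v \<in> orb v" if "v \<in> ?V" for v
    using that one unfolding orb_def by (force intro: image_eqI[of _ _ "\<lambda>v\<in>?V. v"])
  have orb_sub: "orb v \<subseteq> ?V" if "v \<in> ?V" for v using that mapV by (auto simp: orb_def)
  have orb_closed: "orb (f v) = orb v" if fv: "f \<in> H" "v \<in> ?V" for f v
  proof -
    \<comment> \<open>One inclusion for all group elements suffices: applied to \<open>f\<close> and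
      to an element undoing \<open>f\<close>, it gives equality.\<close>
    have le: "orb (f v) \<subseteq> orb v" if "f \<in> H" "v \<in> ?V" for f v
    proof
      fix w assume "w \<in> orb (f v)"
      then obtain g where "g \<in> H" "w = g (f v)" by (auto simp: orb_def)
      then have "w = compose ?V g f v" "compose ?V g f \<in> H" using that comp by (auto simp: compose_eq)
      then show "w \<in> orb v" by (auto simp: orb_def)
    qed
    obtain g where "g \<in> H" "g (f v) = v" using inverse[OF fv(1)] fv(2) by blast
    then show ?thesis using le[of g "f v"] le[OF fv] mapV[OF fv] by auto
  qed
  have Orb_mem: "A \<subseteq> ?V" "\<And>v. v \<in> A \<Longrightarrow> orb v = A" "A \<noteq> {}" "finite A" if A: "A \<in> Orb" for A
  proof -
    obtain u where u: "u \<in> ?V" "A = orb u" using A by (auto simp: Orb_eq orb_def)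
    show "A \<subseteq> ?V" "A \<noteq> {}" using u orb_sub orb_self by auto
    then show "finite A" using fin finite_subset by blast
    fix v assume "v \<in> A"
    then obtain f where "f \<in> H" "v = f u" using u by (auto simp: orb_def)
    then show "orb v = A" using u orb_closed by simp
  qed
  have trans: "\<exists>f\<in>H. w = f v" if "A \<in> Orb" "v \<in> A" "w \<in> A" for A v w
    using Orb_mem(2)[OF that(1,2)] that(3) by (auto simp: orb_def)
  have orb_O: "orb v \<in> Orb" if "v \<in> ?V" for v using that by (auto simp: Orb_eq orb_def)
  have disj: "A \<inter> B = {}" if "A \<in> Orb" "B \<in> Orb" "A \<noteq> B" for A B
    using Orb_mem(2)[OF that(1)] Orb_mem(2)[OF that(2)] that(3) by auto
  have finO: "finite Orb" using fin by (auto simp: Orb_eq)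
  have UO: "\<Union>Orb = ?V" using Orb_mem(1) orb_O orb_self by blast
  note sign = automorphism_nut_vector_sign[OF fin ne span nz aut]
  define sg :: "'a \<Rightarrow> int" where "sg v = (if 0 < x v then 1 else - 1)" for v
  have sg: "sg v = 1 \<or> sg v = - 1" for v by (simp add: sg_def)
  have x_sg: "x v = of_int (sg v) * \<bar>x v\<bar>" for v by (simp add: sg_def)
  \<comment> \<open>A group element may negate all signs at once, but products of two signs and
    absolute values survive.\<close>
  have sg_f: "sg (f v) * sg (f w) = sg v * sg w" and abs_f: "\<bar>x (f v)\<bar> = \<bar>x v\<bar>"
    if f: "f \<in> H" and vw: "v \<in> ?V" "w \<in> ?V" for f v w
  proof -
    obtain c where "c = 1 \<or> c = - 1" "\<And>v. v \<in> ?V \<Longrightarrow> x (f v) = c * x v" using sign f by blast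
    then show "sg (f v) * sg (f w) = sg v * sg w" "\<bar>x (f v)\<bar> = \<bar>x v\<bar>"
      using nz[OF vw(1)] nz[OF vw(2)] vw by (auto simp: sg_def)
  qed
  define rep where "rep A = (SOME v. v \<in> A)" for A :: "'a set"
  have rep: "rep A \<in> A" if "A \<in> Orb" for A using Orb_mem(3)[OF that] by (auto simp: rep_def some_in_eq)
  define nb where "nb v B = {w \<in> B. (v, w) \<in> parcs G}" for v B
  \<comment> \<open>The factor \<open>sg v\<close> makes the entry invariant under elements that
    negate \<open>x\<close>, and makes each edge contribute the same from both ends.\<close>
  define m where "m v B = (\<Sum>w\<in>nb v B. sg v * sg w)" for v B
  define Y where "Y A = \<bar>x (rep A)\<bar>" for A
  have finnb: "finite (nb v B)" if "B \<in> Orb" for v B using Orb_mem(4)[OF that] by (simp add: nb_def)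
  have Y: "\<bar>x v\<bar> = Y A" if "A \<in> Orb" "v \<in> A" for A v
    using trans[OF that(1) rep[OF that(1)] that(2)] abs_f Orb_mem(1)[OF that(1)] rep[OF that(1)]
    by (auto simp: Y_def)
  have Y_pos: "0 < Y A" if "A \<in> Orb" for A
    using nz rep[OF that] Orb_mem(1)[OF that] by (auto simp: Y_def)
  have m_const: "m v B = m (rep A) B" if AB: "A \<in> Orb" "B \<in> Orb" "v \<in> A" for A B v
  proof -
    obtain f where f: "f \<in> H" "v = f (rep A)" using trans[OF AB(1) rep[OF AB(1)] AB(3)] by blast
    have sub: "A \<subseteq> ?V" "B \<subseteq> ?V" using Orb_mem(1) AB by auto
    have rV: "rep A \<in> ?V" using rep AB sub by auto
    have fB: "f w \<in> B" if "w \<in> B" for w using Orb_mem(2)[OF AB(2) that] f(1) by (auto simp: orb_def)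
    obtain g where g: "g \<in> H" "\<forall>v\<in>?V. g (f v) = v" using inverse[OF f(1)] by blast
    have gB: "g w \<in> B" if "w \<in> B" for w using Orb_mem(2)[OF AB(2) that] g(1) by (auto simp: orb_def)
    have inj: "inj_on f ?V" using aut[OF f(1)] by (auto simp: automorphisms_def Bij_def bij_betw_def)
    \<comment> \<open>\<open>g\<close> is given as a left inverse of \<open>f\<close>; as an
      injective self-map of the finite orbit \<open>B\<close>, \<open>f\<close> is onto
      \<open>B\<close>, so \<open>g\<close> is a right inverse there too.\<close>
    have fg: "f (g w) = w" if w: "w \<in> B" for w
    proof -
      have "f ` B \<subseteq> B" "inj_on f B" using fB inj sub inj_on_subset by auto
      then have "f ` B = B" using endo_inj_surj[OF Orb_mem(4)[OF AB(2)]] by blast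
      then obtain w' where "w' \<in> B" "w = f w'" using w by blast
      then show ?thesis using g(2) sub by auto
    qed
    have "(\<Sum>w\<in>nb (rep A) B. sg (rep A) * sg w) = (\<Sum>w\<in>nb v B. sg v * sg w)"
    proof (rule sum.reindex_bij_witness[of _ g f])
      fix w assume w: "w \<in> nb (rep A) B"
      then have wV: "w \<in> ?V" using sub by (auto simp: nb_def)
      show "g (f w) = w" using g(2) wV by blast
      show "f w \<in> nb v B" using w fB arc[OF f(1) rV wV] by (auto simp: nb_def f(2))
      show "sg v * sg (f w) = sg (rep A) * sg w" using sg_f[OF f(1) rV wV] by (simp add: f(2))
    next
      fix w assume w: "w \<in> nb v B"
      then have wB: "w \<in> B" by (simp add: nb_def)
      show "f (g w) = w" by (rule fg[OF wB])
      show "g w \<in> nb (rep A) B"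
        using w gB[OF wB] arc[OF f(1) rV, of "g w"] sub fg[OF wB] by (auto simp: nb_def f(2))
    qed
    then show ?thesis by (simp add: m_def)
  qed
  \<comment> \<open>Double counting: both sides, multiplied by the common orbit size, sum the sign
    products over all edges between \<open>A\<close> and \<open>B\<close>.\<close>
  have m_sym: "m (rep A) B = m (rep B) A" if AB: "A \<in> Orb" "B \<in> Orb" for A B
  proof -
    have expand: "int (card A) * m (rep A) B = (\<Sum>v\<in>A. \<Sum>w\<in>B. if (v, w) \<in> parcs G then sg v * sg w else 0)"
      if "A \<in> Orb" "B \<in> Orb" for A B
    proof -
      have "int (card A) * m (rep A) B = (\<Sum>v\<in>A. m v B)" using m_const[OF that] by simp
      also have "\<dots> = (\<Sum>v\<in>A. \<Sum>w\<in>B. if (v, w) \<in> parcs G then sg v * sg w else 0)"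
        using Orb_mem(4)[OF that(2)] by (simp add: m_def nb_def sum.inter_filter)
      finally show ?thesis .
    qed
    have "int (card A) * m (rep A) B = (\<Sum>w\<in>B. \<Sum>v\<in>A. if (v, w) \<in> parcs G then sg v * sg w else 0)"
      unfolding expand[OF AB] by (rule sum.swap)
    also have "\<dots> = int (card B) * m (rep B) A"
      unfolding expand[OF AB(2,1)] by (intro sum.cong refl) (auto dest: arcs_symmetric)
    finally have "int (card A) * m (rep A) B = int (card A) * m (rep B) A"
      using orbs(2)[folded Orb_def, OF AB] by simp
    moreover have "card A \<noteq> 0" using Orb_mem[OF AB(1)] by simp
    ultimately show ?thesis by simp
  qed
  have nb_union: "(\<Sum>B\<in>Orb. sum g (nb v B)) = sum g {w \<in> ?V. (v, w) \<in> parcs G}" for v and g :: "'a \<Rightarrow> 'b::comm_monoid_add"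
  proof -
    have "sum g (\<Union>B\<in>Orb. nb v B) = (\<Sum>B\<in>Orb. sum g (nb v B))"
    proof (intro sum.UNION_disjoint ballI impI finO finnb)
      show "nb v A \<inter> nb v B = {}" if "A \<in> Orb" "B \<in> Orb" "A \<noteq> B" for A B
        using disj[OF that] unfolding nb_def by blast
    qed
    moreover have "(\<Union>B\<in>Orb. nb v B) = {w \<in> ?V. (v, w) \<in> parcs G}" using UO by (auto simp: nb_def)
    ultimately show ?thesis by simp
  qed
  have deg: "card {w \<in> ?V. (v, w) \<in> parcs G} = 3" if "v \<in> ?V" for v
  proof -
    have "out_arcs (with_proj G) v = Pair v ` {w \<in> ?V. (v, w) \<in> parcs G}"
      using in_arcsD2 by (auto simp: out_arcs_def)
    then have "card (out_arcs (with_proj G) v) = card {w \<in> ?V. (v, w) \<in> parcs G}"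
      by (simp add: card_image inj_on_def)
    then show ?thesis using cub that by (simp add: cubic_def out_degree_def)
  qed
  \<comment> \<open>Each entry is bounded by the number of neighbours in its orbit and has the same
    parity; these numbers add up to 3.\<close>
  have abs_sum: "(\<Sum>B\<in>Orb. \<bar>m (rep A) B\<bar>) \<in> {1, 3}" if A: "A \<in> Orb" for A
  proof -
    have v: "rep A \<in> ?V" using rep Orb_mem(1) A by blast
    have "(\<Sum>B\<in>Orb. card (nb (rep A) B)) = 3"
      using nb_union[of "\<lambda>_. 1::nat" "rep A"] deg[OF v] by simp
    then have three: "(\<Sum>B\<in>Orb. int (card (nb (rep A) B))) = 3"
      by (metis of_nat_numeral of_nat_sum)
    have sgs: "sg (rep A) * sg w = 1 \<or> sg (rep A) * sg w = - 1" for w using sg[of "rep A"] sg[of w] by auto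
    have bnd: "\<bar>m (rep A) B\<bar> \<le> int (card (nb (rep A) B))"
      "even (\<bar>m (rep A) B\<bar> + int (card (nb (rep A) B)))" if "B \<in> Orb" for B
      unfolding m_def using sum_signs_bounds[OF finnb[OF that] sgs] by auto
    have "(\<Sum>B\<in>Orb. \<bar>m (rep A) B\<bar>) \<le> 3" unfolding three[symmetric] using bnd by (intro sum_mono) auto
    moreover have "even (\<Sum>B\<in>Orb. \<bar>m (rep A) B\<bar> + int (card (nb (rep A) B)))"
      using bnd by (intro dvd_sum) auto
    then have "odd (\<Sum>B\<in>Orb. \<bar>m (rep A) B\<bar>)" by (simp add: sum.distrib three)
    moreover have "0 \<le> (\<Sum>B\<in>Orb. \<bar>m (rep A) B\<bar>)" by (intro sum_nonneg) auto
    ultimately show ?thesis unfolding insert_iff empty_iff by presburger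
  qed
  \<comment> \<open>This is the null space equation at \<open>rep A\<close>, multiplied by the sign
    there and grouped by orbits, with \<open>x w\<close> replaced by its sign times
    \<open>Y B\<close>.\<close>
  have ker: "(\<Sum>B\<in>Orb. of_int (m (rep A) B) * Y B) = 0" if A: "A \<in> Orb" for A
  proof -
    have v: "rep A \<in> ?V" using rep Orb_mem(1) A by blast
    have "x \<in> null_space G" unfolding span by (rule fun_vs.span_base) simp
    then have "0 = (\<Sum>w\<in>{w \<in> ?V. (rep A, w) \<in> parcs G}. x w)"
      using v sum_adjacency_matrix[OF fin v] by (auto simp: null_space_def)
    also have "\<dots> = (\<Sum>B\<in>Orb. sum x (nb (rep A) B))" by (rule nb_union[symmetric])
    finally have "0 = of_int (sg (rep A)) * (\<Sum>B\<in>Orb. sum x (nb (rep A) B))" by simp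
    also have "\<dots> = (\<Sum>B\<in>Orb. of_int (m (rep A) B) * Y B)"
      unfolding sum_distrib_left[of _ _ Orb]
    proof (intro sum.cong refl)
      fix B assume B: "B \<in> Orb"
      have "sum x (nb (rep A) B) = (\<Sum>w\<in>nb (rep A) B. of_int (sg w) * Y B)"
        using Y[OF B] x_sg by (intro sum.cong refl) (metis (no_types, lifting) mem_Collect_eq nb_def)
      then show "of_int (sg (rep A)) * sum x (nb (rep A) B) = of_int (m (rep A) B) * Y B"
        by (simp add: m_def sum_distrib_left sum_distrib_right algebra_simps)
    qed
    finally show ?thesis by simp
  qed
  obtain xs where xs: "set xs = Orb" "distinct xs" using finite_distinct_list[OF finO] by blast
  \<comment> \<open>Sorting by \<open>- Y\<close> lists the orbits with nonincreasing weights, the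
    order in which definiteness is tested.\<close>
  define os where "os = sort_key (\<lambda>A. - Y A) xs"
  have os: "set os = Orb" "distinct os" "length os = l"
    using xs orbs(1)[folded Orb_def] distinct_card[OF xs(2)] by (auto simp: os_def)
  have mem: "os ! i \<in> Orb" if "i < l" for i using that os nth_mem by metis
  have sum_os: "(\<Sum>j<l. g (os ! j)) = sum g Orb" for g :: "'a set \<Rightarrow> 'c::comm_monoid_add"
    using sum.reindex_bij_betw[OF bij_betw_nth[OF os(2) _ os(1)[symmetric]], of "{..<l}" g] os(3) by simp
  have srt: "sorted (map (\<lambda>A. - Y A) os)" unfolding os_def by simp
  show False
  proof (rule refuted_imp_no_positive_kernel[OF ref,
        where M = "\<lambda>i j. m (rep (os ! i)) (os ! j)" and y = "\<lambda>i. Y (os ! i)"])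
    show "Y (os ! j) \<le> Y (os ! i)" if "i < j" "j < l" for i j
      using sorted_nth_mono[OF srt, of i j] that os(3) by simp
    fix i assume i: "i < l"
    show "0 < Y (os ! i)" by (rule Y_pos[OF mem[OF i]])
    show "(\<Sum>j<l. \<bar>m (rep (os ! i)) (os ! j)\<bar>) \<in> {1, 3}"
      unfolding sum_os[of "\<lambda>B. \<bar>m (rep (os ! i)) B\<bar>"] by (rule abs_sum[OF mem[OF i]])
    show "(\<Sum>j<l. of_int (m (rep (os ! i)) (os ! j)) * Y (os ! j)) = 0"
      unfolding sum_os[of "\<lambda>B. of_int (m (rep (os ! i)) B) * Y B"] by (rule ker[OF mem[OF i]])
    show "m (rep (os ! i)) (os ! j) = m (rep (os ! j)) (os ! i)" if "j < l" for j
      by (rule m_sym[OF mem[OF i] mem[OF that]])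
  qed
qed

section \<open>Voltage graphs\<close>

lemma sum_periodic_shift:
  fixes g :: "int \<Rightarrow> 'a::comm_monoid_add"
  assumes "0 < n" and per: "\<And>p. g (p mod n) = g p"
  shows "(\<Sum>p\<in>{0..<n}. g (p + a)) = (\<Sum>p\<in>{0..<n}. g p)"
proof (rule sum.reindex_bij_witness[of _ "\<lambda>p. (p - a) mod n" "\<lambda>p. (p + a) mod n"])
  show "g ((p + a) mod n) = g (p + a)" for p by (rule per)
qed (use \<open>0 < n\<close> in \<open>auto simp: mod_simps\<close>)

text \<open>Injectivity of the discrete Fourier transform: the polynomial with coefficients
  \<open>c\<close> has degree below \<open>n\<close> but vanishes at all \<open>n\<close> roots of
  unity.\<close>

lemma vanishing_at_roots_of_unity:
  fixes c :: "nat \<Rightarrow> complex"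
  assumes "0 < n" and zero: "\<And>w. w ^ n = 1 \<Longrightarrow> (\<Sum>p<n. c p * w ^ p) = 0" and "p < n"
  shows "c p = 0"
proof -
  define P where "P = (\<Sum>p<n. monom (c p) p)"
  have "P = 0"
  proof (rule ccontr)
    assume P: "P \<noteq> 0"
    have "degree P \<le> n - 1"
      unfolding P_def by (intro degree_sum_le) (auto intro: order_trans[OF degree_monom_le])
    have "n = card {w::complex. w ^ n = 1}" using card_roots_unity_eq[OF \<open>0 < n\<close>] by simp
    also have "\<dots> \<le> card {w. poly P w = 0}"
      using poly_roots_finite[OF P] zero by (intro card_mono) (auto simp: P_def poly_sum poly_monom)
    also have "\<dots> \<le> degree P" by (rule card_poly_roots_bound[OF P])
    finally show False using \<open>degree P \<le> n - 1\<close> \<open>0 < n\<close> by simp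
  qed
  moreover have "coeff P p = c p" using \<open>p < n\<close> by (simp add: P_def coeff_sum)
  ultimately show ?thesis by simp
qed

lemma power_int_mod:
  fixes z :: "'a::field"
  assumes "z \<noteq> 0" "z ^ n = 1"
  shows "z powi (p mod int n) = z powi p"
proof -
  have "z powi p = z powi (int n * (p div int n) + p mod int n)" by simp
  also have "\<dots> = (z powi int n) powi (p div int n) * z powi (p mod int n)"
    using assms(1) by (subst power_int_add) (auto simp: power_int_mult)
  finally show ?thesis using assms(2) by simp
qed

section \<open>Cubic graphs derived from voltages\<close>

definition vtx :: "nat \<Rightarrow> nat \<Rightarrow> int \<Rightarrow> nat" where
  "vtx n j p = j * n + nat (p mod int n)"

text \<open>
  The vertex \<open>j * n + p\<close> is the element \<open>p\<close> of the \<open>j\<close>-th copy of the integers modulo \<open>n\<close>. A dart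
  \<open>(j, a)\<close> at orbit \<open>i\<close> joins \<open>(i, p)\<close> to \<open>(j, p + a)\<close>; a loop gives two darts \<open>a\<close> and \<open>- a\<close>, and a
  semi-edge gives the single dart \<open>n / 2\<close>.
\<close>

definition voltage_graph :: "nat \<Rightarrow> nat \<Rightarrow> (nat \<Rightarrow> (nat \<times> int) list) \<Rightarrow> nat pair_pre_digraph" where
  "voltage_graph l n D =
     \<lparr>pverts = {..<l * n}, parcs = {(vtx n i p, vtx n j (p + a)) | i p j a. i < l \<and> (j, a) \<in> set (D i)}\<rparr>"

text \<open>Conditions under which the derived graph is simple and cubic: darts distinct modulo
  \<open>n\<close> exclude multiple edges, reverse darts give symmetry, and \<open>no_loop\<close>
  keeps a vertex from being joined to itself.\<close>

locale cubic_voltage =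
  fixes l n :: nat and D :: "nat \<Rightarrow> (nat \<times> int) list"
  assumes l_pos: "0 < l" and n_ge: "2 \<le> n"
    and length_darts: "i < l \<Longrightarrow> length (D i) = 3"
    and dart_less: "i < l \<Longrightarrow> (j, a) \<in> set (D i) \<Longrightarrow> j < l"
    and distinct_darts: "i < l \<Longrightarrow> distinct (map (\<lambda>(j, a). (j, a mod int n)) (D i))"
    and reverse_dart: "i < l \<Longrightarrow> (j, a) \<in> set (D i) \<Longrightarrow> \<exists>b. (i, b) \<in> set (D j) \<and> int n dvd a + b"
    and no_loop: "i < l \<Longrightarrow> (i, a) \<in> set (D i) \<Longrightarrow> \<not> int n dvd a"
begin

abbreviation "G \<equiv> voltage_graph l n D"
abbreviation "vx \<equiv> vtx n"

lemma n_pos: "0 < n" using n_ge by simp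

lemma vx_div: "vx j p div n = j"
proof -
  have "nat (p mod int n) < n" using n_pos by (simp add: nat_less_iff)
  then show ?thesis by (simp add: vtx_def)
qed

lemma vx_mod: "int (vx j p mod n) = p mod int n"
proof -
  have "nat (p mod int n) < n" using n_pos by (simp add: nat_less_iff)
  then show ?thesis using n_pos by (simp add: vtx_def)
qed

lemma vx_eq_iff: "vx i p = vx j q \<longleftrightarrow> i = j \<and> p mod int n = q mod int n"
  by (metis vx_div vx_mod vtx_def)

lemma vx_mod_arg [simp]: "vx j (p mod int n) = vx j p"
  by (simp add: vx_eq_iff)

lemma vx_of: "u = vx (u div n) (int (u mod n))"
  by (simp add: vtx_def flip: zmod_int)

lemma vx_in: "vx j p < l * n \<longleftrightarrow> j < l"
  using div_less_iff_less_mult[OF n_pos, of "vx j p" l] by (simp add: vx_div)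

lemma verts_cases:
  assumes "u \<in> pverts G"
  obtains i p where "i < l" "u = vx i p"
  using assms vx_of[of u] vx_in[of "u div n" "int (u mod n)"] by (auto simp: voltage_graph_def)

lemma vx_in_verts [simp]: "vx j p \<in> pverts G \<longleftrightarrow> j < l"
  by (simp add: voltage_graph_def vx_in)

lemma finite_verts: "finite (pverts G)" by (simp add: voltage_graph_def)

lemma arc_iff: "(vx i p, v) \<in> parcs G \<longleftrightarrow> i < l \<and> (\<exists>(j, a) \<in> set (D i). v = vx j (p + a))"
proof
  assume "(vx i p, v) \<in> parcs G"
  then obtain i' p' j a where *: "vx i p = vx i' p'" "v = vx j (p' + a)" "i' < l" "(j, a) \<in> set (D i')"
    by (auto simp: voltage_graph_def)
  then have "i' = i" "p' mod int n = p mod int n" by (auto simp: vx_eq_iff)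
  then have "vx j (p' + a) = vx j (p + a)" unfolding vx_eq_iff by (metis mod_add_left_eq)
  then show "i < l \<and> (\<exists>(j, a) \<in> set (D i). v = vx j (p + a))" using * \<open>i' = i\<close> by auto
qed (auto simp: voltage_graph_def)

lemma neighbours_eq:
  assumes "i < l"
  shows "{v \<in> pverts G. (vx i p, v) \<in> parcs G} = (\<lambda>(j, a). vx j (p + a)) ` set (D i)"
  using assms dart_less[OF assms] by (auto simp: arc_iff image_iff)

lemma inj_darts:
  assumes "i < l"
  shows "inj_on (\<lambda>(j, a). vx j (p + a)) (set (D i))"
proof (rule inj_onI, clarify)
  fix j a k b assume d: "(j, a) \<in> set (D i)" "(k, b) \<in> set (D i)" and "vx j (p + a) = vx k (p + b)"
  then have "j = k" "(p + a) mod int n = (p + b) mod int n" by (auto simp: vx_eq_iff)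
  then have eq: "(case (j, a) of (j, a) \<Rightarrow> (j, a mod int n)) = (case (k, b) of (j, a) \<Rightarrow> (j, a mod int n))"
    by (simp add: mod_eq_dvd_iff)
  have "inj_on (\<lambda>(j, a). (j, a mod int n)) (set (D i))"
    using distinct_darts[OF assms] by (simp add: distinct_map)
  from inj_onD[OF this eq d] show "j = k \<and> a = b" by simp
qed

lemma distinct_D: "i < l \<Longrightarrow> distinct (D i)"
  using distinct_darts by (simp add: distinct_map)

lemma sum_neighbours:
  assumes "i < l"
  shows "(\<Sum>v\<in>pverts G. adjacency_matrix G (vx i p) v * x v) = (\<Sum>(j, a)\<leftarrow>D i. x (vx j (p + a)))"
proof -
  have "(\<Sum>v\<in>pverts G. adjacency_matrix G (vx i p) v * x v) = sum x {v \<in> pverts G. (vx i p, v) \<in> parcs G}"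
    using assms by (intro sum_adjacency_matrix) (auto simp: finite_verts)
  also have "\<dots> = (\<Sum>d\<in>set (D i). x (case d of (j, a) \<Rightarrow> vx j (p + a)))"
    unfolding neighbours_eq[OF assms] by (subst sum.reindex[OF inj_darts[OF assms]]) simp
  also have "\<dots> = (\<Sum>(j, a)\<leftarrow>D i. x (vx j (p + a)))"
    by (simp add: sum.distinct_set_conv_list[OF distinct_D[OF assms]] case_prod_unfold)
  finally show ?thesis .
qed

lemma pair_graph: "pair_graph G"
proof
  fix e assume e: "e \<in> parcs G"
  then obtain i p j a where *: "e = (vx i p, vx j (p + a))" "i < l" "(j, a) \<in> set (D i)"
    by (auto simp: voltage_graph_def)
  then show "fst e \<in> pverts G" "snd e \<in> pverts G" using dart_less by auto
  have "\<not> int n dvd a" if "i = j" using no_loop * that by auto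
  then show "fst e \<noteq> snd e" using * by (auto simp: vx_eq_iff mod_eq_dvd_iff)
next
  show "finite (pverts G)" by (rule finite_verts)
  have "parcs G \<subseteq> pverts G \<times> pverts G" using dart_less by (auto simp: voltage_graph_def vx_in)
  then show "finite (parcs G)" using finite_verts finite_subset by blast
  show "symmetric (with_proj G)"
    unfolding symmetric_def with_proj_simps
  proof (rule symI)
    fix u v assume "(u, v) \<in> parcs G"
    then obtain i p j a where *: "u = vx i p" "v = vx j (p + a)" "i < l" "(j, a) \<in> set (D i)"
      by (auto simp: voltage_graph_def)
    from reverse_dart[OF this(3,4)] obtain b where b: "(i, b) \<in> set (D j)" "int n dvd a + b" by blast
    then have "(p + a + b) mod int n = p mod int n" by (simp add: mod_eq_dvd_iff add.assoc)
    then have "u = vx i (p + a + b)" by (simp add: * vx_eq_iff)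
    then show "(v, u) \<in> parcs G" using b(1) dart_less[OF *(3,4)] by (auto simp: *(2) arc_iff)
  qed
qed

lemma cubic: "cubic G"
  unfolding cubic_def
proof
  fix v assume "v \<in> pverts G"
  then obtain i p where v: "i < l" "v = vx i p" by (rule verts_cases)
  have "out_arcs (with_proj G) v = Pair v ` {w \<in> pverts G. (v, w) \<in> parcs G}"
    using pair_graph unfolding pair_graph_def pair_digraph_def pair_fin_digraph_def
    by (auto simp: out_arcs_def dest: pair_wf_digraph.in_arcsD2)
  then have "out_degree (with_proj G) v = card {w \<in> pverts G. (v, w) \<in> parcs G}"
    by (simp add: out_degree_def card_image inj_on_def)
  also have "\<dots> = card (set (D i))" unfolding v(2) neighbours_eq[OF v(1)] by (rule card_image[OF inj_darts[OF v(1)]])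
  finally show "out_degree (with_proj G) v = 3"
    using distinct_card[OF distinct_D] length_darts v(1) by simp
qed

text \<open>Restricted to the vertices because elements of \<open>Bij\<close> are
  extensional.\<close>

definition rotation :: "int \<Rightarrow> nat \<Rightarrow> nat" where
  "rotation k = (\<lambda>u\<in>pverts G. vx (u div n) (int (u mod n) + k))"

lemma rotation_vx: "j < l \<Longrightarrow> rotation k (vx j p) = vx j (p + k)"
  by (simp add: rotation_def vx_div vx_mod vx_eq_iff mod_simps)

lemma rotation_extensional: "rotation k \<in> extensional (pverts G)"
  by (simp add: rotation_def)

lemma rotation_automorphism: "rotation k \<in> automorphisms G"
proof -
  have "bij_betw (rotation k) (pverts G) (pverts G)"
  proof (rule bij_betwI[where g = "rotation (- k)"])
    show "rotation k \<in> pverts G \<rightarrow> pverts G" "rotation (- k) \<in> pverts G \<rightarrow> pverts G"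
      by (auto elim!: verts_cases simp: rotation_vx)
  qed (auto elim!: verts_cases simp: rotation_vx)
  moreover have "(rotation k u, rotation k v) \<in> parcs G \<longleftrightarrow> (u, v) \<in> parcs G"
    if "u \<in> pverts G" "v \<in> pverts G" for u v
  proof -
    from that obtain i p j q where *: "i < l" "j < l" "u = vx i p" "v = vx j q" by (auto elim!: verts_cases)
    have "(q + k) mod int n = (p + k + a) mod int n \<longleftrightarrow> q mod int n = (p + a) mod int n" for a
      by (simp add: mod_eq_dvd_iff algebra_simps)
    then show ?thesis using * by (simp add: rotation_vx arc_iff vx_eq_iff)
  qed
  ultimately show ?thesis by (simp add: automorphisms_def Bij_def rotation_extensional)
qed

lemma rotation_hom: "group_hom integer_group (automorphism_group G) rotation"
proof (intro group_hom.intro group_hom_axioms.intro group_integer_group group_automorphism_group homI)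
  show "rotation k \<in> carrier (automorphism_group G)" for k
    by (simp add: automorphism_group_def rotation_automorphism)
  fix k m
  have "rotation (k + m) = compose (pverts G) (rotation k) (rotation m)"
  proof (rule extensionalityI[of _ "pverts G"])
    fix u assume "u \<in> pverts G"
    then show "rotation (k + m) u = compose (pverts G) (rotation k) (rotation m) u"
      by (auto elim!: verts_cases simp: rotation_vx compose_def algebra_simps)
  qed (auto simp: rotation_extensional)
  then show "rotation (k \<otimes>\<^bsub>integer_group\<^esub> m) = rotation k \<otimes>\<^bsub>automorphism_group G\<^esub> rotation m"
    using rotation_automorphism[of k] rotation_automorphism[of m]
    by (simp add: automorphism_group_def BijGroup_def automorphisms_def)
qed

text \<open>The rotations are the image of the integers under a homomorphism, hence a cyclic group;
  its orbits are the \<open>l\<close> copies of the integers modulo \<open>n\<close>.\<close>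

lemma circulant: "circulant l G"
proof -
  let ?H = "range rotation"
  let ?C = "(automorphism_group G)\<lparr>carrier := ?H\<rparr>"
  interpret rot: group_hom integer_group "automorphism_group G" rotation by (rule rotation_hom)
  have sub: "subgroup ?H (automorphism_group G)" using rot.img_is_subgroup by simp
  have grp: "group ?C" by (rule group.subgroup_imp_group[OF group_automorphism_group sub])
  have "rotation \<in> epi integer_group ?C"
    using rot.homh by (auto simp: epi_def hom_def)
  then have cyc: "cyclic_group ?C"
    using group.cyclic_group_epimorphic_image[OF group_integer_group] cyclic_integer_group grp by blast
  have orbit: "orbit ?C (\<lambda>f. f) (vx j p) = range (vx j)" if "j < l" for j p
  proof -
    have "vx j q \<in> {g (vx j p) | g. g \<in> ?H}" for q
      using rotation_vx[OF that, of "q - p" p] by (auto intro!: exI[of _ "rotation (q - p)"])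
    then show ?thesis using that by (auto simp: orbit_def rotation_vx)
  qed
  have "orbits ?C (pverts G) (\<lambda>f. f) = (\<lambda>j. range (vx j)) ` {..<l}"
  proof
    show "orbits ?C (pverts G) (\<lambda>f. f) \<subseteq> (\<lambda>j. range (vx j)) ` {..<l}"
      by (auto simp: orbits_def orbit elim!: verts_cases)
    show "(\<lambda>j. range (vx j)) ` {..<l} \<subseteq> orbits ?C (pverts G) (\<lambda>f. f)"
    proof clarify
      fix j assume "j < l"
      then have "range (vx j) = orbit ?C (\<lambda>f. f) (vx j 0)" "vx j 0 \<in> pverts G" by (simp_all add: orbit)
      then show "range (vx j) \<in> orbits ?C (pverts G) (\<lambda>f. f)" unfolding orbits_def by blast
    qed
  qed
  moreover have "inj_on (\<lambda>j. range (vx j)) {..<l}"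
  proof (rule inj_onI)
    fix i j assume "range (vx i) = range (vx j)"
    then obtain p where "vx i 0 = vx j p" by blast
    then show "i = j" by (simp add: vx_eq_iff)
  qed
  moreover have "card (range (vx j)) = n" for j
  proof -
    have "range (vx j) = vx j ` {0..<int n}"
    proof
      show "range (vx j) \<subseteq> vx j ` {0..<int n}"
      proof clarify
        fix p show "vx j p \<in> vx j ` {0..<int n}"
          using n_pos by (intro image_eqI[of _ _ "p mod int n"]) auto
      qed
    qed auto
    moreover have "inj_on (vx j) {0..<int n}" by (auto simp: inj_on_def vx_eq_iff)
    ultimately show ?thesis by (simp add: card_image)
  qed
  ultimately show ?thesis
    unfolding circulant_def Let_def using sub cyc by (intro exI[of _ ?H]) (auto simp: card_image)
qed

text \<open>The Fourier coefficients of a null vector at \<open>z\<close> form a kernel vector of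
  the voltage matrix at \<open>z\<close>, so they vanish unless \<open>z\<close> is
  \<open>\<epsilon>\<close>. Hence the null vector is a geometric progression of ratio
  \<open>\<epsilon>\<close> on each orbit, and \<open>ker_line\<close> links the orbits.\<close>

lemma nut_graph:
  fixes \<epsilon> :: real and y :: "nat \<Rightarrow> real"
  assumes eps: "\<epsilon> = 1 \<or> \<epsilon> = - 1" "\<epsilon> ^ n = 1"
    and y0: "y 0 = 1" and y_nz: "\<And>j. j < l \<Longrightarrow> y j \<noteq> 0"
    and y_ker: "\<And>i. i < l \<Longrightarrow> (\<Sum>(j, a)\<leftarrow>D i. \<epsilon> powi a * y j) = 0"
    and ker_trivial: "\<And>z F j. z ^ n = 1 \<Longrightarrow> z \<noteq> of_real \<epsilon> \<Longrightarrow>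
      (\<And>i. i < l \<Longrightarrow> (\<Sum>(j, a)\<leftarrow>D i. z powi a * F j) = 0) \<Longrightarrow> j < l \<Longrightarrow> F j = (0::complex)"
    and ker_line: "\<And>F j. (\<And>i. i < l \<Longrightarrow> (\<Sum>(j, a)\<leftarrow>D i. of_real \<epsilon> powi a * F j) = 0) \<Longrightarrow>
      j < l \<Longrightarrow> F j = F 0 * complex_of_real (y j)"
  shows "nut_graph G"
proof -
  have eps_nz: "\<epsilon> \<noteq> 0" using eps by auto
  have eps_mod: "\<epsilon> powi (p mod int n) = \<epsilon> powi p" for p by (rule power_int_mod[OF eps_nz eps(2)])
  define x where "x u = (if u \<in> pverts G then \<epsilon> powi int (u mod n) * y (u div n) else 0)" for u
  have x_vx: "x (vx j p) = \<epsilon> powi p * y j" if "j < l" for j p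
    using that by (simp add: x_def vx_mod vx_div eps_mod)
  have null_iff: "f \<in> null_space G \<longleftrightarrow>
      (\<forall>v. v \<notin> pverts G \<longrightarrow> f v = 0) \<and> (\<forall>i<l. \<forall>p. (\<Sum>(j, a)\<leftarrow>D i. f (vx j (p + a))) = 0)" for f
  proof -
    have "(\<forall>u\<in>pverts G. (\<Sum>v\<in>pverts G. adjacency_matrix G u v * f v) = 0) \<longleftrightarrow>
        (\<forall>i<l. \<forall>p. (\<Sum>(j, a)\<leftarrow>D i. f (vx j (p + a))) = 0)"
    proof safe
      fix i p assume "\<forall>u\<in>pverts G. (\<Sum>v\<in>pverts G. adjacency_matrix G u v * f v) = 0" "i < l"
      then show "(\<Sum>(j, a)\<leftarrow>D i. f (vx j (p + a))) = 0"
        using sum_neighbours[of i p f] vx_in_verts[of i p] by metis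
    next
      fix u assume *: "\<forall>i<l. \<forall>p. (\<Sum>(j, a)\<leftarrow>D i. f (vx j (p + a))) = 0" and "u \<in> pverts G"
      then obtain i p where "i < l" "u = vx i p" by (auto elim: verts_cases)
      then show "(\<Sum>v\<in>pverts G. adjacency_matrix G u v * f v) = 0"
        using sum_neighbours[of i p f] * by simp
    qed
    then show ?thesis by (simp add: null_space_def)
  qed
  have x_null: "x \<in> null_space G"
    unfolding null_iff
  proof (intro conjI allI impI)
    fix i p assume i: "i < l"
    have "(\<Sum>(j, a)\<leftarrow>D i. x (vx j (p + a))) = (\<Sum>(j, a)\<leftarrow>D i. \<epsilon> powi p * (\<epsilon> powi a * y j))"
      using dart_less[OF i] eps_nz
      by (intro arg_cong[where f = sum_list] map_cong) (auto simp: x_vx power_int_add)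
    also have "\<dots> = \<epsilon> powi p * (\<Sum>(j, a)\<leftarrow>D i. \<epsilon> powi a * y j)"
      by (simp add: sum_list_const_mult[symmetric] case_prod_unfold)
    also have "\<dots> = 0" by (simp add: y_ker[OF i])
    finally show "(\<Sum>(j, a)\<leftarrow>D i. x (vx j (p + a))) = 0" .
  qed (simp add: x_def)
  have "f \<in> range (\<lambda>c v. c * x v)" if f: "f \<in> null_space G" for f
  proof -
    have f0: "f v = 0" if "v \<notin> pverts G" for v using f that by (auto simp: null_iff)
    have f_sum: "(\<Sum>(j, a)\<leftarrow>D i. f (vx j (p + a))) = 0" if "i < l" for i p
      using f that by (auto simp: null_iff)
    \<comment> \<open>The transform of this twisted difference is that of \<open>f\<close> times
      \<open>z - \<epsilon>\<close>. It vanishes at every root of unity: by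
      \<open>ker_trivial\<close> away from \<open>\<epsilon>\<close>, by the factor at
      \<open>\<epsilon>\<close>.\<close>
    define c where "c j p = f (vx j (p + 1)) - \<epsilon> * f (vx j p)" for j p
    have hat: "(\<Sum>p\<in>{0..<int n}. of_real (c j p) * z powi (- p)) = (0::complex)"
      if z: "z ^ n = 1" and j: "j < l" for z j
    proof -
      have z_nz: "z \<noteq> 0" using z n_pos by (auto simp: power_0_left)
      have z_mod: "z powi (- (p mod int n)) = z powi (- p)" for p
        unfolding power_int_minus power_int_mod[OF z_nz z] ..
      define F where "F j = (\<Sum>p\<in>{0..<int n}. of_real (f (vx j p)) * z powi (- p))" for j
      have shift: "(\<Sum>p\<in>{0..<int n}. of_real (f (vx j (p + a))) * z powi (- p)) = z powi a * F j" for j a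
      proof -
        have "(\<Sum>p\<in>{0..<int n}. of_real (f (vx j (p + a))) * z powi (- p)) =
            (\<Sum>p\<in>{0..<int n}. z powi a * (of_real (f (vx j (p + a))) * z powi (- (p + a))))"
          using z_nz by (intro sum.cong refl) (simp add: power_int_diff power_int_minus field_simps power_int_add)
        also have "\<dots> = (\<Sum>p\<in>{0..<int n}. z powi a * (of_real (f (vx j p)) * z powi (- p)))"
          using n_pos by (intro sum_periodic_shift[where g = "\<lambda>p. z powi a * (of_real (f (vx j p)) * z powi (- p))"])
            (simp_all add: z_mod)
        finally show ?thesis by (simp add: F_def sum_distrib_left)
      qed
      have sum_list_swap: "(\<Sum>(j, a)\<leftarrow>ds. \<Sum>p\<in>{0..<int n}. of_real (f (vx j (p + a))) * z powi (- p)) =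
          (\<Sum>p\<in>{0..<int n}. of_real (\<Sum>(j, a)\<leftarrow>ds. f (vx j (p + a))) * z powi (- p))" for ds
        by (induction ds) (auto simp: sum.distrib algebra_simps)
      have F_ker: "(\<Sum>(j, a)\<leftarrow>D i. z powi a * F j) = 0" if i: "i < l" for i
      proof -
        have "(\<Sum>(j, a)\<leftarrow>D i. z powi a * F j) =
            (\<Sum>(j, a)\<leftarrow>D i. \<Sum>p\<in>{0..<int n}. of_real (f (vx j (p + a))) * z powi (- p))"
          by (simp add: shift)
        also have "\<dots> = (\<Sum>p\<in>{0..<int n}. of_real (\<Sum>(j, a)\<leftarrow>D i. f (vx j (p + a))) * z powi (- p))"
          by (rule sum_list_swap)
        also have "\<dots> = 0" by (simp add: f_sum[OF i])
        finally show ?thesis .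
      qed
      have "(\<Sum>p\<in>{0..<int n}. of_real (c j p) * z powi (- p)) =
          (\<Sum>p\<in>{0..<int n}. of_real (f (vx j (p + 1))) * z powi (- p)) - of_real \<epsilon> * F j"
        by (simp add: c_def F_def sum_subtractf sum_distrib_left algebra_simps)
      also have "\<dots> = (z - of_real \<epsilon>) * F j" unfolding shift by (simp add: left_diff_distrib)
      also have "\<dots> = 0" using ker_trivial[OF z _ F_ker j] by auto
      finally show ?thesis .
    qed
    have c0: "c j (int p) = 0" if j: "j < l" and p: "p < n" for j p
    proof -
      have "(\<Sum>p<n. complex_of_real (c j (int p)) * w ^ p) = 0" if w: "w ^ n = 1" for w
      proof -
        \<comment> \<open>The transform uses negative exponents; evaluating it at the inverse of
          \<open>w\<close> gives an ordinary polynomial in \<open>w\<close>.\<close>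
        have "inverse w ^ n = 1" using w by (simp add: power_inverse)
        then have "0 = (\<Sum>p\<in>{0..<int n}. complex_of_real (c j p) * inverse w powi (- p))" using hat j by simp
        also have "\<dots> = (\<Sum>p<n. complex_of_real (c j (int p)) * inverse w powi (- int p))"
          by (rule sum.reindex_bij_witness[of _ int nat]) auto
        also have "\<dots> = (\<Sum>p<n. complex_of_real (c j (int p)) * w ^ p)"
          by (intro sum.cong refl) (simp add: power_int_minus power_inverse)
        finally show ?thesis by simp
      qed
      from vanishing_at_roots_of_unity[OF n_pos this p] show ?thesis by simp
    qed
    have f_pow: "f (vx j (int p)) = \<epsilon> ^ p * f (vx j 0)" if j: "j < l" and "p \<le> n" for j p
      using \<open>p \<le> n\<close>
    proof (induction p)
      case (Suc p)
      then have "f (vx j (int p + 1)) = \<epsilon> * f (vx j (int p))" using c0[OF j, of p] by (simp add: c_def)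
      then show ?case using Suc by (simp add: algebra_simps)
    qed simp
    have f_all: "f (vx j p) = \<epsilon> powi p * f (vx j 0)" if j: "j < l" for j p
    proof -
      have "f (vx j p) = f (vx j (int (nat (p mod int n))))" using n_pos by simp
      also have "\<dots> = \<epsilon> ^ nat (p mod int n) * f (vx j 0)"
        using n_pos by (intro f_pow[OF j]) (simp add: nat_le_iff less_imp_le)
      also have "\<epsilon> ^ nat (p mod int n) = \<epsilon> powi (p mod int n)" using n_pos by (simp add: power_int_def)
      finally show ?thesis by (simp add: eps_mod)
    qed
    have of_real_sum_list_swap: "(\<Sum>(j, a)\<leftarrow>ds. of_real \<epsilon> powi a * complex_of_real (f (vx j 0))) =
        complex_of_real (\<Sum>(j, a)\<leftarrow>ds. \<epsilon> powi a * f (vx j 0))" for ds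
      by (induction ds) auto
    \<comment> \<open>The equations at position 0 of each orbit say that the starting values form a
      kernel vector at \<open>\<epsilon>\<close>; they are embedded in the complex numbers to apply
      \<open>ker_line\<close>.\<close>
    have line: "f (vx j 0) = f (vx 0 0) * y j" if "j < l" for j
    proof -
      have "complex_of_real (f (vx j 0)) = complex_of_real (f (vx 0 0)) * complex_of_real (y j)"
      proof (rule ker_line[of "\<lambda>j. complex_of_real (f (vx j 0))" j, OF _ that])
        fix i assume i: "i < l"
        have "(\<Sum>(j, a)\<leftarrow>D i. of_real \<epsilon> powi a * complex_of_real (f (vx j 0))) =
            complex_of_real (\<Sum>(j, a)\<leftarrow>D i. \<epsilon> powi a * f (vx j 0))"
          by (rule of_real_sum_list_swap)
        also have "(\<Sum>(j, a)\<leftarrow>D i. \<epsilon> powi a * f (vx j 0)) = (\<Sum>(j, a)\<leftarrow>D i. f (vx j (0 + a)))"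
        proof (intro arg_cong[where f = sum_list] map_cong refl, clarify)
          fix j a assume "(j, a) \<in> set (D i)"
          from f_all[OF dart_less[OF i this], of a] show "\<epsilon> powi a * f (vx j 0) = f (vx j (0 + a))" by simp
        qed
        also have "\<dots> = 0" using f_sum[OF i, of 0] by simp
        finally show "(\<Sum>(j, a)\<leftarrow>D i. of_real \<epsilon> powi a * complex_of_real (f (vx j 0))) = 0" by simp
      qed
      then show ?thesis by (metis of_real_eq_iff of_real_mult)
    qed
    have "f v = f (vx 0 0) * x v" for v
    proof (cases "v \<in> pverts G")
      case True
      then obtain j p where jp: "j < l" "v = vx j p" by (rule verts_cases)
      show ?thesis unfolding jp(2) x_vx[OF jp(1)] f_all[OF jp(1), of p] line[OF jp(1)] by simp
    qed (simp add: f0 x_def)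
    then have "f = (\<lambda>v. f (vx 0 0) * x v)" by (rule ext)
    then show ?thesis by (rule range_eqI)
  qed
  moreover have "(\<lambda>v. c * x v) \<in> null_space G" for c
  proof -
    have "(\<Sum>(j, a)\<leftarrow>D i. c * x (vx j (p + a))) = c * (\<Sum>(j, a)\<leftarrow>D i. x (vx j (p + a)))" for i p
      by (simp add: sum_list_const_mult[symmetric] case_prod_unfold)
    then show ?thesis using x_null by (simp add: null_iff)
  qed
  ultimately have null: "null_space G = fun_vs.span {x}" unfolding fun_vs.span_singleton by auto
  have x_nz: "x v \<noteq> 0" if "v \<in> pverts G" for v
    using that y_nz eps_nz by (auto elim!: verts_cases simp: x_vx)
  have "vx 0 0 \<in> pverts G" using l_pos by simp
  then have "x \<noteq> 0" using x_nz by (metis zero_fun_apply)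
  then have "fun_vs.independent {x}" by (simp add: fun_vs.dependent_single)
  then have "fun_vs.dim (null_space G) = card {x}"
    unfolding null by (intro fun_vs.dim_eq_card) (simp_all add: fun_vs.span_span)
  moreover have "card (pverts G) \<ge> 2"
    using l_pos n_ge by (simp add: voltage_graph_def) (metis One_nat_def Suc_leI le_trans mult_le_mono1 nat_mult_1)
  ultimately show ?thesis
    unfolding nut_graph_def using pair_graph null x_nz by auto
qed

end

section \<open>Three families\<close>

text \<open>
  If \<open>u = 2 * w\<close>, then \<open>u ^ n = p * u + q\<close> with \<open>p\<close> odd, so \<open>w ^ n = 1\<close> would make \<open>u\<close> real.
\<close>

lemma half_trace_not_root_of_unity:
  fixes w s :: complex
  assumes s: "s = 1 \<or> s = - 1" and w: "2 * w\<^sup>2 - s * w + 2 = 0"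
  shows "w ^ n \<noteq> 1 \<or> n = 0"
proof (cases n)
  case (Suc k)
  define t :: int where "t = (if s = 1 then 1 else - 1)"
  have t: "s = of_int t" "odd t" "t\<^sup>2 = 1" using s by (auto simp: t_def)
  define u where "u = 2 * w"
  have u2: "u\<^sup>2 = of_int t * u - 4"
    using w unfolding u_def t(1) by (simp add: power2_eq_square algebra_simps) algebra
  have "\<exists>p q :: int. odd p \<and> even q \<and> u ^ Suc k = of_int p * u + of_int q" for k
  proof (induction k)
    case 0
    show ?case by (rule exI[of _ 1], rule exI[of _ 0]) simp
  next
    case (Suc k)
    then obtain p q :: int where pq: "odd p" "even q" "u ^ Suc k = of_int p * u + of_int q" by blast
    have "u ^ Suc (Suc k) = of_int p * u\<^sup>2 + of_int q * u"
      using pq(3) by (simp add: power2_eq_square algebra_simps)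
    also have "\<dots> = of_int (t * p + q) * u + of_int (- 4 * p)"
      unfolding u2 by (simp add: algebra_simps)
    finally show ?case using pq(1,2) t(2) by (intro exI[of _ "t * p + q"] exI[of _ "- 4 * p"]) auto
  qed
  then obtain p q :: int where pq: "odd p" "u ^ n = of_int p * u + of_int q" using Suc by blast
  show ?thesis
  proof (rule ccontr)
    assume "\<not> ?thesis"
    then have "u ^ n = 2 ^ n" by (simp add: u_def power_mult_distrib)
    moreover have "p \<noteq> 0" using pq(1) by auto
    ultimately have "u = of_real ((2 ^ n - of_int q) / of_int p)"
      using pq(2) by (simp add: field_simps)
    then obtain a :: real where "u = of_real a" by blast
    with u2 have "of_real (a\<^sup>2 - of_int t * a + 4) = (0 :: complex)" by simp
    then have "a\<^sup>2 - of_int t * a + 4 = 0" using of_real_eq_0_iff by blast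
    \<comment> \<open>Completing the square: the discriminant is 1 - 16 = - 15, so there is no real
      root.\<close>
    moreover have "(2 * a - of_int t)\<^sup>2 = 4 * (a\<^sup>2 - of_int t * a + 4) - 15"
      using arg_cong[OF t(3), of real_of_int] by (simp add: power2_eq_square algebra_simps)
    ultimately have "(2 * a - of_int t)\<^sup>2 < 0" by simp
    then show False by (simp add: not_less[symmetric])
  qed
qed simp

text \<open>Here \<open>u\<close>, the square of \<open>z\<close>, is a root of unity of odd order,
  so neither \<open>u\<close> nor its square is \<open>- 1\<close>; this excludes the values 0 and
  \<open>- 2\<close> for \<open>C\<close>. If \<open>C = 2\<close>, then \<open>u = 1\<close>, so
  \<open>z\<close> is a sign, and \<open>z = z ^ m = s\<close> because \<open>m\<close> is odd. The
  last claim is \<open>half_trace_not_root_of_unity\<close> for \<open>u\<close>.\<close>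

lemma root_of_unity_trace:
  fixes z s C :: complex
  assumes z: "z ^ (2 * m) = 1" and m: "odd m" and s: "s = z ^ m" and C: "C = z powi 2 + z powi (- 2)"
  shows "s * s = 1" "C \<noteq> 0" "1 + z powi 4 \<noteq> 0" "(1 + z powi 4) * (1 + z powi (- 4)) = C * C"
    "C = 2 * s \<Longrightarrow> z = 1" "C = - 2 * s \<Longrightarrow> z = - 1" "2 * C \<noteq> s"
proof -
  have m0: "m \<noteq> 0" using odd_pos[OF m] by simp
  have z0: "z \<noteq> 0" using z m0 by (auto simp: power_0_left)
  show ss: "s * s = 1" using z by (simp add: s flip: power_add mult_2)
  then have s1: "s = 1 \<or> s = - 1" by (simp add: square_eq_1_iff)
  define u v where "u = z\<^sup>2" and "v = inverse u"
  have uv: "u * v = 1" using z0 by (simp add: u_def v_def)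
  have w: "u ^ m = 1" using z by (simp add: u_def power_mult)
  have z4: "z ^ 4 = u\<^sup>2" by (simp add: u_def flip: power_mult)
  have C': "C = u + v" by (simp add: C u_def v_def power_int_minus)
  have f: "1 + z powi 4 = 1 + u\<^sup>2" "1 + z powi (- 4) = 1 + v\<^sup>2"
    by (simp_all add: z4 v_def power_int_minus power_inverse)
  have no: "u\<^sup>2 \<noteq> - 1" "u \<noteq> - 1"
  proof
    assume "u\<^sup>2 = - 1"
    then have "(u ^ m)\<^sup>2 = - 1" using m by (simp flip: power_mult add: mult.commute[of m 2]) (simp add: power_mult)
    then show False using w by simp
  next
    show "u \<noteq> - 1" using w m by auto
  qed
  show "C \<noteq> 0"
  proof
    assume "C = 0"
    then have "u\<^sup>2 = - 1" using C' uv by algebra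
    then show False using no by simp
  qed
  show "1 + z powi 4 \<noteq> 0" unfolding f using no(1) by (metis add_eq_0_iff)
  show "(1 + z powi 4) * (1 + z powi (- 4)) = C * C" unfolding f C' using uv by algebra
  have two: "z = 1 \<or> z = - 1" if "C = 2"
  proof -
    have "(u - 1)\<^sup>2 = 0" using C' uv that by algebra
    then show ?thesis by (simp add: u_def power2_eq_1_iff)
  qed
  have minus_two: "C \<noteq> - 2"
  proof
    assume "C = - 2"
    then have "(u + 1)\<^sup>2 = 0" using C' uv by algebra
    then show False using no(2) by (simp add: add_eq_0_iff2)
  qed
  show "z = 1" if "C = 2 * s" using s1 two minus_two that m by (auto simp: s)
  show "z = - 1" if "C = - 2 * s" using s1 two minus_two that m by (auto simp: s)
  show "2 * C \<noteq> s"
  proof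
    assume "2 * C = s"
    then have "s * u = 2 * (u * u) + 2 * (u * v)" using C' by (simp add: algebra_simps flip: \<open>2 * C = s\<close>)
    then have "2 * u\<^sup>2 - s * u + 2 = 0" using uv by (simp add: power2_eq_square)
    from half_trace_not_root_of_unity[OF s1 this, of m] w m0 show False by blast
  qed
qed

section \<open>Propagation along the tail\<close>

fun tail_vector :: "'a::field \<Rightarrow> 'a \<Rightarrow> nat \<Rightarrow> 'a" where
  "tail_vector s c 0 = 1"
| "tail_vector s c (Suc 0) = - c"
| "tail_vector s c (Suc (Suc i)) = - tail_vector s c i - s * tail_vector s c (Suc i)"

text \<open>Since \<open>s * s = 1\<close>, the characteristic polynomial
  \<open>x * x + s * x + 1\<close> divides \<open>x ^ 3 - s\<close>: three steps multiply by
  \<open>s\<close>.\<close>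

lemma tail_vector_period:
  assumes "s * s = 1"
  shows "tail_vector s c (3 * k + i) = s ^ k * tail_vector s c i"
proof (induction k)
  case (Suc k)
  have step: "tail_vector s c (Suc (Suc (Suc j))) = s * tail_vector s c j" for j
    using assms by (simp add: algebra_simps)
  have "3 * Suc k + i = Suc (Suc (Suc (3 * k + i)))" by simp
  then show ?case using Suc by (simp only: step power_Suc mult.assoc)
qed simp

text \<open>The equation at orbit 0 (loop factor \<open>c\<close>) and those at the semi-edges
  (factor \<open>s\<close>) determine each next value, so the tail is a multiple of
  \<open>tail_vector\<close>.\<close>

lemma tail_solution:
  fixes F :: "nat \<Rightarrow> 'a::field"
  assumes F0: "c * F 0 + F (Suc 0) = 0"
    and rec: "\<And>i. Suc i \<le> t \<Longrightarrow> F i + s * F (Suc i) + F (Suc (Suc i)) = 0"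
  shows "i \<le> Suc t \<Longrightarrow> F i = tail_vector s c i * F 0"
proof (induction i rule: induct_nat_012)
  case 1
  show ?case using F0 by (simp add: add_eq_0_iff)
next
  case (ge2 i)
  have "F (Suc (Suc i)) = - F i - s * F (Suc i)"
    using rec[of i] ge2.prems by (simp add: add_eq_0_iff)
  also have "\<dots> = tail_vector s c (Suc (Suc i)) * F 0"
    using ge2 by (simp add: algebra_simps)
  finally show ?case .
qed simp

text \<open>
  Orbit \<open>0\<close> carries a loop of voltage \<open>2\<close>, orbits \<open>1, \<dots>, t\<close> carry a semi-edge of voltage \<open>m\<close>
  (half the period), and consecutive orbits are joined. The orbits after \<open>t\<close> are described by
  \<open>hs\<close>, where orbit indices are taken relative to \<open>t\<close>.
\<close>

definition chain_darts :: "nat \<Rightarrow> nat \<Rightarrow> (nat \<times> int) list list \<Rightarrow> nat \<Rightarrow> (nat \<times> int) list" where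
  "chain_darts m t hs i =
     (if i = 0 then [(0, 2), (0, - 2), (1, 0)]
      else if i \<le> t then [(i - 1, 0), (i, int m), (i + 1, 0)]
      else map (\<lambda>(k, a). (t + k, a)) (hs ! (i - Suc t)))"

definition valid_head :: "int \<Rightarrow> (nat \<times> int) list list \<Rightarrow> bool" where
  "valid_head n hs \<longleftrightarrow> hs \<noteq> [] \<and> (0, 0) \<in> set (hs ! 0) \<and>
     (\<forall>d<length hs. length (hs ! d) = 3 \<and> distinct (map (\<lambda>(k, a). (k, a mod n)) (hs ! d)) \<and>
        (\<forall>(k, a) \<in> set (hs ! d). k \<le> length hs \<and> (k = Suc d \<longrightarrow> \<not> n dvd a) \<and>
           (if k = 0 then d = 0 \<and> a = 0 else \<exists>b. (Suc d, b) \<in> set (hs ! (k - 1)) \<and> n dvd a + b)))"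

lemma chain_darts_0: "chain_darts m t hs 0 = [(0, 2), (0, - 2), (1, 0)]"
  and chain_darts_tail: "1 \<le> i \<Longrightarrow> i \<le> t \<Longrightarrow> chain_darts m t hs i = [(i - 1, 0), (i, int m), (i + 1, 0)]"
  and chain_darts_head: "chain_darts m t hs (Suc t + d) = map (\<lambda>(k, a). (t + k, a)) (hs ! d)"
  by (simp_all add: chain_darts_def)

lemma chain_cases:
  assumes "i < Suc t + h"
  obtains "i = 0" | "1 \<le> i" "i \<le> t" | d where "d < h" "i = Suc t + d"
proof (cases "i \<le> t")
  case False
  then have "i = Suc t + (i - Suc t)" "i - Suc t < h" using assms by auto
  then show ?thesis using that(3) by blast
qed (use that in \<open>cases i; auto\<close>)

lemma not_double_dvd:
  assumes "3 \<le> m" "odd m"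
  shows "\<not> 2 * int m dvd 2" "\<not> 2 * int m dvd 4" "\<not> 2 * int m dvd int m"
proof -
  show "\<not> 2 * int m dvd 2" "\<not> 2 * int m dvd 4"
    using assms zdvd_imp_le[of "2 * int m" 2] zdvd_imp_le[of "2 * int m" 4] by auto
  show "\<not> 2 * int m dvd int m" using assms zdvd_imp_le[of "2 * int m" "int m"] by auto
qed

lemma chain_cubic_voltage:
  assumes m: "3 \<le> m" "odd m" and t: "1 \<le> t" and hs: "valid_head (2 * int m) hs"
  shows "cubic_voltage (Suc t + length hs) (2 * m) (chain_darts m t hs)"
proof
  let ?D = "chain_darts m t hs" and ?h = "length hs" and ?n = "2 * int m"
  have h0: "0 < ?h" "(0, 0) \<in> set (hs ! 0)" using hs by (auto simp: valid_head_def)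
  have hd: "length (hs ! d) = 3" "distinct (map (\<lambda>(k, a). (k, a mod ?n)) (hs ! d))" if "d < ?h" for d
    using hs that by (auto simp: valid_head_def)
  have hk: "k \<le> ?h" "k = Suc d \<Longrightarrow> \<not> ?n dvd a" "k = 0 \<Longrightarrow> d = 0 \<and> a = 0"
    "k \<noteq> 0 \<Longrightarrow> \<exists>b. (Suc d, b) \<in> set (hs ! (k - 1)) \<and> ?n dvd a + b"
    if "d < ?h" "(k, a) \<in> set (hs ! d)" for d k a
  proof -
    have "k \<le> length hs \<and> (k = Suc d \<longrightarrow> \<not> ?n dvd a) \<and>
        (if k = 0 then d = 0 \<and> a = 0 else \<exists>b. (Suc d, b) \<in> set (hs ! (k - 1)) \<and> ?n dvd a + b)"
      using hs that unfolding valid_head_def by blast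
    then show "k \<le> ?h" "k = Suc d \<Longrightarrow> \<not> ?n dvd a" "k = 0 \<Longrightarrow> d = 0 \<and> a = 0"
      "k \<noteq> 0 \<Longrightarrow> \<exists>b. (Suc d, b) \<in> set (hs ! (k - 1)) \<and> ?n dvd a + b"
      by (auto split: if_splits)
  qed
  show "0 < Suc t + ?h" "2 \<le> 2 * m" using m by auto
  fix i assume "i < Suc t + ?h"
  then show "length (?D i) = 3"
    by (cases rule: chain_cases) (simp_all add: chain_darts_0 chain_darts_tail chain_darts_head hd del: add_Suc)
  show "distinct (map (\<lambda>(j, a). (j, a mod int (2 * m))) (?D i))"
    using \<open>i < Suc t + ?h\<close>
  proof (cases rule: chain_cases)
    case 1
    have "(- 2) mod int (2 * m) \<noteq> 2 mod int (2 * m)"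
      unfolding mod_eq_dvd_iff using not_double_dvd[OF m] by simp
    then show ?thesis using 1 by (auto simp: chain_darts_0)
  next
    case 2
    then show ?thesis by (cases i) (auto simp: chain_darts_tail)
  next
    case (3 d)
    have "map (\<lambda>(j, a). (j, a mod int (2 * m))) (?D i) =
        map (\<lambda>(k, a). (t + k, a)) (map (\<lambda>(k, a). (k, a mod ?n)) (hs ! d))"
      unfolding 3 chain_darts_head by (simp add: case_prod_unfold)
    moreover have "inj (\<lambda>(k, a :: int). (t + k, a))" by (auto simp: inj_on_def)
    ultimately show ?thesis using hd(2)[OF 3(1)] by (simp only: distinct_map) (meson inj_on_subset subset_UNIV)
  qed
  show "\<not> int (2 * m) dvd a" if ia: "(i, a) \<in> set (?D i)" for a
    using \<open>i < Suc t + ?h\<close>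
  proof (cases rule: chain_cases)
    case 1
    then show ?thesis using ia not_double_dvd[OF m] by (auto simp: chain_darts_0)
  next
    case 2
    then show ?thesis using ia not_double_dvd[OF m] by (auto simp: chain_darts_tail)
  next
    case (3 d)
    then obtain k where "(k, a) \<in> set (hs ! d)" "t + k = Suc t + d"
      using ia unfolding 3 chain_darts_head by auto
    then show ?thesis using hk(2)[OF 3(1)] by simp
  qed
  fix j a assume ja: "(j, a) \<in> set (?D i)"
  \<comment> \<open>The edge between consecutive orbits, seen from its two ends. At
    \<open>i = t\<close> the upper end is the dart \<open>(0, 0)\<close> of the head.\<close>
  have up: "(Suc i, 0) \<in> set (?D i)" if "i \<le> t" for i
    using that by (cases "i = 0") (auto simp: chain_darts_0 chain_darts_tail)
  have down: "(i, 0) \<in> set (?D (Suc i))" if "i \<le> t" for i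
  proof (cases "Suc i \<le> t")
    case False
    then have "i = t" using that by simp
    then show ?thesis using chain_darts_head[of m t hs 0] h0(2) by force
  qed (simp add: chain_darts_tail)
  have "j < Suc t + ?h \<and> (\<exists>b. (i, b) \<in> set (?D j) \<and> int (2 * m) dvd a + b)"
    using \<open>i < Suc t + ?h\<close>
  proof (cases rule: chain_cases)
    case 1
    then consider "(j, a) = (0, 2)" | "(j, a) = (0, - 2)" | "(j, a) = (1, 0)"
      using ja by (auto simp: chain_darts_0)
    then show ?thesis
    proof cases
      case 1 then show ?thesis using \<open>i = 0\<close> by (auto simp: chain_darts_0 intro!: exI[of _ "- 2"])
    next
      case 2 then show ?thesis using \<open>i = 0\<close> by (auto simp: chain_darts_0 intro!: exI[of _ "2"])
    next
      case 3 then show ?thesis using \<open>i = 0\<close> down[of 0] t by (auto intro!: exI[of _ "0"])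
    qed
  next
    case 2
    then consider "(j, a) = (i - 1, 0)" | "(j, a) = (i, int m)" | "(j, a) = (Suc i, 0)"
      using ja by (auto simp: chain_darts_tail)
    then show ?thesis
    proof cases
      case 1 then show ?thesis using 2 up[of "i - 1"] by (auto intro!: exI[of _ "0"])
    next
      \<comment> \<open>A semi-edge is its own reverse, since \<open>m + m\<close> is the
        period.\<close>
      case 2 then show ?thesis using \<open>1 \<le> i\<close> \<open>i \<le> t\<close> by (auto simp: chain_darts_tail intro!: exI[of _ "int m"])
    next
      case 3 then show ?thesis using 2 down[of i] h0(1) by (auto intro!: exI[of _ "0"] simp del: length_greater_0_conv)
    qed
  next
    case (3 d)
    then obtain k where k: "(k, a) \<in> set (hs ! d)" "j = t + k"
      using ja unfolding 3 chain_darts_head by auto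
    note hk = hk[OF 3(1) k(1)]
    show ?thesis
    proof (cases "k = 0")
      case True
      then show ?thesis using hk(3) k(2) 3 up[of t] by (auto intro!: exI[of _ "0"])
    next
      case False
      then obtain b where b: "(Suc d, b) \<in> set (hs ! (k - 1))" "?n dvd a + b" using hk(4) by blast
      have "?D j = map (\<lambda>(k, a). (t + k, a)) (hs ! (k - 1))"
        using chain_darts_head[of m t hs "k - 1"] False by (simp add: k(2))
      then have "(i, b) \<in> set (?D j)" using b(1) by (force simp: 3)
      then show ?thesis using b(2) hk(1) by (auto simp: k(2))
    qed
  qed
  then show "j < Suc t + ?h" "\<exists>b. (i, b) \<in> set (?D j) \<and> int (2 * m) dvd a + b" by auto
qed

lemma chain_tail_solution:
  fixes F :: "nat \<Rightarrow> 'a::field"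
  assumes "1 \<le> t" "0 < length hs"
    and sys: "\<And>i. i < Suc t + length hs \<Longrightarrow> (\<Sum>(j, a)\<leftarrow>chain_darts m t hs i. z powi a * F j) = 0"
    and "i \<le> Suc t"
  shows "F i = tail_vector (z ^ m) (z powi 2 + z powi (- 2)) i * F 0"
proof (rule tail_solution[OF _ _ \<open>i \<le> Suc t\<close>])
  show "(z powi 2 + z powi (- 2)) * F 0 + F (Suc 0) = 0"
    using sys[of 0] by (simp add: chain_darts_0 algebra_simps)
  show "F i + z ^ m * F (Suc i) + F (Suc (Suc i)) = 0" if "Suc i \<le> t" for i
    using sys[of "Suc i"] that by (simp add: chain_darts_tail algebra_simps)
qed

text \<open>By periodicity only 1, \<open>- c\<close> and \<open>s * c - 1\<close> occur, up to
  sign.\<close>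

lemma tail_vector_nonzero:
  fixes s c :: "'a::field"
  assumes "s * s = 1" "c \<noteq> 0" "s * c \<noteq> 1"
  shows "tail_vector s c i \<noteq> 0"
proof -
  have "i = 3 * (i div 3) + i mod 3" by simp
  then have "tail_vector s c i = s ^ (i div 3) * tail_vector s c (i mod 3)"
    using tail_vector_period[OF assms(1), of c "i div 3" "i mod 3"] by metis
  moreover have "tail_vector s c (i mod 3) \<noteq> 0"
  proof -
    have "i mod 3 = 0 \<or> i mod 3 = Suc 0 \<or> i mod 3 = Suc (Suc 0)" by arith
    then show ?thesis using assms(2,3) by auto
  qed
  ultimately show ?thesis using assms(1) by auto
qed

section \<open>The three heads\<close>

definition head0 :: "(nat \<times> int) list list" where
  "head0 = [[(0, 0), (1, 2), (1, - 2)]]"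

text \<open>A 4-cycle of orbits 1, 2, 4, 3 with semi-edges at 2 and 3, closed off by a looped orbit
  5 attached to 4.\<close>

definition head1 :: "int \<Rightarrow> (nat \<times> int) list list" where
  "head1 m = [[(0, 0), (2, 0), (3, 0)], [(1, 0), (2, m), (4, 0)], [(1, 0), (3, m), (4, 0)],
     [(2, 0), (3, 0), (5, 0)], [(4, 0), (5, 2), (5, - 2)]]"

text \<open>A path 1, ..., 6 with double edges 1-2 and 4-5 and a semi-edge at 3, ending in two
  looped orbits attached to 6. A double edge contributes \<open>1 + z powi 4\<close> or
  \<open>1 + z powi (- 4)\<close>, depending on direction, and their product is the square of the
  loop factor.\<close>

definition head2 :: "int \<Rightarrow> (nat \<times> int) list list" where
  "head2 m = [[(0, 0), (2, 0), (2, 4)], [(1, 0), (1, - 4), (3, 0)], [(2, 0), (3, m), (4, 0)],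
     [(3, 0), (5, 0), (5, 4)], [(4, 0), (4, - 4), (6, 0)], [(5, 0), (7, 0), (8, 0)],
     [(6, 0), (7, 2), (7, - 2)], [(6, 0), (8, 2), (8, - 2)]]"

lemma mod_double_neq:
  assumes "3 \<le> m" "odd m"
  shows "2 mod (2 * int m) \<noteq> (- 2) mod (2 * int m)" "4 mod (2 * int m) \<noteq> 0" "(- 4) mod (2 * int m) \<noteq> 0"
  using not_double_dvd[OF assms] unfolding mod_eq_dvd_iff mod_eq_0_iff_dvd by simp_all

lemma valid_heads:
  assumes "3 \<le> m" "odd m"
  shows "valid_head (2 * int m) head0" "valid_head (2 * int m) (head1 (int m))" "valid_head (2 * int m) (head2 (int m))"
  unfolding valid_head_def head0_def head1_def head2_def
  using mod_double_neq[OF assms] not_double_dvd[OF assms]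
  by (auto simp: less_Suc_eq)


lemma of_real_tail_vector: "tail_vector (of_real s) (of_real c) i = (of_real (tail_vector s c i) :: complex)"
  by (induction s c i rule: tail_vector.induct) simp_all

lemma sum_list_head:
  "(\<Sum>(j, a)\<leftarrow>chain_darts m t hs (Suc t + d). g j a) = (\<Sum>(k, a)\<leftarrow>hs ! d. g (t + k) a)"
  unfolding chain_darts_head by (simp add: o_def case_prod_unfold)

text \<open>The tail is solved once for all heads, so only the head equations remain to be checked.
  At \<open>z = \<epsilon>\<close> the parameters are \<open>s = \<epsilon>\<close>, because
  \<open>m\<close> is odd, and \<open>c = 2\<close>.\<close>

lemma chain_nut_graph:
  fixes \<epsilon> :: real and y :: "nat \<Rightarrow> real"
  assumes m: "3 \<le> m" "odd m" and t: "1 \<le> t" and hs: "valid_head (2 * int m) hs" and eps: "\<epsilon> = 1 \<or> \<epsilon> = - 1"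
    and y_tail: "\<And>i. i \<le> Suc t \<Longrightarrow> y i = tail_vector \<epsilon> 2 i"
    and y_nz: "\<And>d. d < length hs \<Longrightarrow> y (Suc t + d) \<noteq> 0"
    and y_head: "\<And>d. d < length hs \<Longrightarrow> (\<Sum>(k, a)\<leftarrow>hs ! d. \<epsilon> powi a * y (t + k)) = 0"
    and trivial: "\<And>z F s c d. z ^ (2 * m) = 1 \<Longrightarrow> s = z ^ m \<Longrightarrow> c = z powi 2 + z powi (- 2) \<Longrightarrow>
      z \<noteq> of_real \<epsilon> \<Longrightarrow> F t = tail_vector s c t * F 0 \<Longrightarrow> F (Suc t) = tail_vector s c (Suc t) * F 0 \<Longrightarrow>
      (\<And>d. d < length hs \<Longrightarrow> (\<Sum>(k, a)\<leftarrow>hs ! d. z powi a * F (t + k)) = 0) \<Longrightarrow>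
      F 0 = (0::complex) \<and> (d < length hs \<longrightarrow> F (Suc t + d) = 0)"
    and line: "\<And>F d. F t = F 0 * of_real (y t) \<Longrightarrow> F (Suc t) = F 0 * of_real (y (Suc t)) \<Longrightarrow>
      (\<And>d. d < length hs \<Longrightarrow> (\<Sum>(k, a)\<leftarrow>hs ! d. of_real \<epsilon> powi a * F (t + k)) = 0) \<Longrightarrow>
      d < length hs \<Longrightarrow> F (Suc t + d) = F 0 * complex_of_real (y (Suc t + d))"
  shows "nut_graph (voltage_graph (Suc t + length hs) (2 * m) (chain_darts m t hs))"
proof -
  let ?D = "chain_darts m t hs" and ?l = "Suc t + length hs"
  interpret cubic_voltage ?l "2 * m" ?D by (rule chain_cubic_voltage[OF m t hs])
  have h0: "0 < length hs" using hs by (auto simp: valid_head_def)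
  have ee: "\<epsilon> * \<epsilon> = 1" "\<epsilon> ^ m = \<epsilon>" "\<epsilon> powi 2 + \<epsilon> powi (- 2) = 2" using eps m(2) by auto
  have tv: "tail_vector \<epsilon> 2 i \<noteq> 0" for i by (rule tail_vector_nonzero) (use eps in auto)
  show ?thesis
  proof (rule nut_graph[where \<epsilon> = \<epsilon> and y = y])
    show "\<epsilon> = 1 \<or> \<epsilon> = - 1" by (rule eps)
    show "\<epsilon> ^ (2 * m) = 1" using eps by auto
    show "y 0 = 1" by (simp add: y_tail)
    show "y i \<noteq> 0" if "i < ?l" for i
      using that
    proof (cases rule: chain_cases)
      case (3 d)
      then show ?thesis using y_nz by simp
    qed (use tv in \<open>auto simp: y_tail\<close>)
    show "(\<Sum>(j, a)\<leftarrow>?D i. \<epsilon> powi a * y j) = 0" if "i < ?l" for i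
      using that
    proof (cases rule: chain_cases)
      case 1
      then show ?thesis using ee(3) by (simp add: chain_darts_0 y_tail)
    next
      case 2
      then show ?thesis using ee(2) by (cases i) (auto simp: chain_darts_tail y_tail)
    next
      case (3 d)
      then show ?thesis using y_head[of d] by (simp only: sum_list_head)
    qed
  next
    fix z F j assume z: "z ^ (2 * m) = 1" "z \<noteq> of_real \<epsilon>" and j: "j < ?l"
      and sys: "\<And>i. i < ?l \<Longrightarrow> (\<Sum>(j, a)\<leftarrow>?D i. z powi a * F j) = (0::complex)"
    have F: "F i = tail_vector (z ^ m) (z powi 2 + z powi (- 2)) i * F 0" if "i \<le> Suc t" for i
      by (rule chain_tail_solution[OF t h0 sys that])
    have "(\<Sum>(k, a)\<leftarrow>hs ! d. z powi a * F (t + k)) = 0" if "d < length hs" for d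
      using sys[of "Suc t + d"] that by (simp only: sum_list_head add_less_cancel_left)
    then have *: "F 0 = 0 \<and> (d < length hs \<longrightarrow> F (Suc t + d) = 0)" for d
      by (intro trivial[OF z(1) refl refl z(2)] F) simp_all
    show "F j = 0"
      using j
    proof (cases rule: chain_cases)
      case (3 d)
      then show ?thesis using *[of d] by simp
    qed (use * F[of j] in auto)
  next
    fix F j assume j: "j < ?l"
      and sys: "\<And>i. i < ?l \<Longrightarrow> (\<Sum>(j, a)\<leftarrow>?D i. of_real \<epsilon> powi a * F j) = (0::complex)"
    have F: "F i = F 0 * of_real (y i)" if "i \<le> Suc t" for i
    proof -
      have "F i = tail_vector (of_real \<epsilon> ^ m) (of_real \<epsilon> powi 2 + of_real \<epsilon> powi (- 2)) i * F 0"
        by (rule chain_tail_solution[OF t h0 sys that])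
      also have "of_real \<epsilon> ^ m = complex_of_real \<epsilon>" using ee(2) by (simp flip: of_real_power)
      also have "of_real \<epsilon> powi 2 + of_real \<epsilon> powi (- 2) = complex_of_real 2"
        using eps by auto
      finally show ?thesis by (simp add: of_real_tail_vector y_tail[OF that] del: of_real_numeral)
    qed
    show "F j = F 0 * of_real (y j)"
      using j
    proof (cases rule: chain_cases)
      case (3 d)
      have "(\<Sum>(k, a)\<leftarrow>hs ! d. of_real \<epsilon> powi a * F (t + k)) = 0" if "d < length hs" for d
        using sys[of "Suc t + d"] that by (simp only: sum_list_head add_less_cancel_left)
      then show ?thesis unfolding 3 using 3(1) by (intro line F) simp_all
    qed (use F[of j] in auto)
  qed
qed

section \<open>Nut graphs from each head\<close>

lemma tail_vector_values:
  fixes s c :: "'a::field"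
  assumes "s * s = 1"
  shows "tail_vector s c (Suc (3 * k)) = - (s ^ k * c)" "tail_vector s c (Suc (Suc (3 * k))) = s ^ k * (s * c - 1)"
    "tail_vector s c (Suc (Suc (Suc (3 * k)))) = s ^ k * s"
proof -
  show "tail_vector s c (Suc (3 * k)) = - (s ^ k * c)"
    using tail_vector_period[OF assms, of c k "Suc 0"] by simp
  show "tail_vector s c (Suc (Suc (3 * k))) = s ^ k * (s * c - 1)"
    using tail_vector_period[OF assms, of c k "Suc (Suc 0)"] tail_vector.simps(3)[of s c 0]
    by (simp del: tail_vector.simps(3))
  have "Suc (Suc (Suc (3 * k))) = 3 * Suc k + 0" by simp
  then show "tail_vector s c (Suc (Suc (Suc (3 * k)))) = s ^ k * s"
    by (simp only: tail_vector_period[OF assms]) (simp add: mult.commute)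
qed

text \<open>The single head equation reduces to \<open>c * (s * c - 2)\<close> times
  \<open>F 0\<close>, up to a sign. Here \<open>c\<close> is nonzero and \<open>c = 2 * s\<close>
  only at \<open>z = 1\<close>, so the exceptional root is 1.\<close>

lemma nut_family0:
  assumes m: "3 \<le> m" "odd m" and t: "t = Suc (3 * k)"
  shows "nut_graph (voltage_graph (Suc t + length head0) (2 * m) (chain_darts m t head0))"
proof (rule chain_nut_graph[OF m _ valid_heads(1)[OF m], where \<epsilon> = 1 and y = "tail_vector 1 2"])
  fix z F s c d
  assume z: "z ^ (2 * m) = 1" and s: "s = z ^ m" and c: "c = z powi 2 + z powi (- 2)" and "z \<noteq> of_real 1"
    and F: "F t = tail_vector s c t * F 0" "F (Suc t) = tail_vector s c (Suc t) * F 0"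
    and sys: "\<And>d. d < length head0 \<Longrightarrow> (\<Sum>(k, a)\<leftarrow>head0 ! d. z powi a * F (t + k)) = (0::complex)"
  note tr = root_of_unity_trace[OF z m(2) s c]
  have "s * c \<noteq> 2"
  proof
    assume "s * c = 2"
    moreover have "c = s * (s * c)" using tr(1) by (simp flip: mult.assoc)
    ultimately have "c = 2 * s" by simp
    then show False using tr(5) \<open>z \<noteq> of_real 1\<close> by simp
  qed
  have "F t + c * F (Suc t) = 0" using sys[of 0] by (simp add: head0_def c algebra_simps)
  then have "s ^ k * (c * (s * c - 2)) * F 0 = 0"
    unfolding F unfolding t tail_vector_values[OF tr(1)] by (simp add: algebra_simps)
  moreover have "s \<noteq> 0" using tr(1) by auto
  ultimately have "F 0 = 0" using \<open>s * c \<noteq> 2\<close> tr(2) by simp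
  then show "F 0 = 0 \<and> (d < length head0 \<longrightarrow> F (Suc t + d) = 0)" using F by (simp add: head0_def)
next
  fix d assume "d < length head0"
  then show "(\<Sum>(k, a)\<leftarrow>head0 ! d. 1 powi a * tail_vector 1 2 (t + k)) = (0::real)"
    unfolding t using tail_vector_values[of "1::real" 2 k] by (simp add: head0_def del: tail_vector.simps(3))
next
  show "tail_vector 1 2 (Suc t + d) \<noteq> (0::real)" for d by (rule tail_vector_nonzero) auto
qed (auto simp: t head0_def)

text \<open>The polynomial left after eliminating \<open>head1\<close> or \<open>head2\<close>; it
  factors because \<open>s * s = 1\<close>.\<close>

lemma quadratic_nonzero:
  fixes s c :: complex
  assumes "s * s = 1" "c \<noteq> - 2 * s" "2 * c \<noteq> s"
  shows "2 * (c * c) + 3 * (s * c) - 2 \<noteq> 0"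
proof -
  have "2 * (c * c) + 3 * (s * c) - 2 = (2 * c - s) * (c + 2 * s)" using assms(1) by algebra
  moreover have "2 * c - s \<noteq> 0" "c + 2 * s \<noteq> 0" using assms(2,3) by (auto simp: eq_neg_iff_add_eq_0)
  ultimately show ?thesis by simp
qed

lemma nut_family1:
  assumes m: "3 \<le> m" "odd m" and t: "t = Suc (3 * k)"
  shows "nut_graph (voltage_graph (Suc t + length (head1 (int m))) (2 * m) (chain_darts m t (head1 (int m))))"
proof -
  define y :: "nat \<Rightarrow> real"
    \<comment> \<open>The listed values solve the head equations at \<open>z = - 1\<close>, where
      \<open>s = - 1\<close> and \<open>c = 2\<close>; the power of \<open>- 1\<close> comes from
      the period of the tail.\<close>
    where "y i = (if i \<le> Suc t then tail_vector (- 1) 2 i else (- 1) ^ k * [1, 1, 4, - 2] ! (i - Suc (Suc t)))" for i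
  have y: "y t = - 2 * (- 1) ^ k" "y (Suc t) = - 3 * (- 1) ^ k" "y (Suc (Suc t)) = (- 1) ^ k"
    "y (Suc (Suc (Suc t))) = (- 1) ^ k" "y (Suc (Suc (Suc (Suc t)))) = 4 * (- 1) ^ k"
    "y (Suc (Suc (Suc (Suc (Suc t))))) = - 2 * (- 1) ^ k"
    using tail_vector_values[of "- 1 :: real" 2 k] by (simp_all add: y_def t del: tail_vector.simps(3))
  have five: "d = 0 \<or> d = 1 \<or> d = 2 \<or> d = 3 \<or> d = 4" if "d < length (head1 (int m))" for d
    using that by (auto simp: head1_def)
  show ?thesis
  proof (rule chain_nut_graph[OF m _ valid_heads(2)[OF m], where \<epsilon> = "- 1" and y = y])
    fix z F s c d
    assume z: "z ^ (2 * m) = 1" and s: "s = z ^ m" and c: "c = z powi 2 + z powi (- 2)" and z1: "z \<noteq> of_real (- 1)"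
      and F: "F t = tail_vector s c t * F 0" "F (Suc t) = tail_vector s c (Suc t) * F 0"
      and sys: "\<And>d. d < length (head1 (int m)) \<Longrightarrow> (\<Sum>(k, a)\<leftarrow>head1 (int m) ! d. z powi a * F (t + k)) = (0::complex)"
    note tr = root_of_unity_trace[OF z m(2) s c]
    have e: "F t + F (t + 2) + F (t + 3) = 0" "F (t + 1) + s * F (t + 2) + F (t + 4) = 0"
      "F (t + 1) + s * F (t + 3) + F (t + 4) = 0" "F (t + 2) + F (t + 3) + F (t + 5) = 0" "F (t + 4) + c * F (t + 5) = 0"
      using sys[of 0] sys[of 1] sys[of 2] sys[of 3] sys[of 4]
      by (simp_all add: head1_def s c algebra_simps)
    have s0: "s \<noteq> 0" using tr(1) by auto
    have e23: "F (t + 2) = F (t + 3)"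
    proof -
      have "s * F (t + 2) = s * F (t + 3)" using e(2,3) by algebra
      then show ?thesis using s0 by simp
    qed
    define P where "P = s ^ k * F 0"
    have P: "F t = - (c * P)" "F (t + 1) = (s * c - 1) * P"
      using F unfolding t tail_vector_values[OF tr(1)] by (simp_all add: P_def)
    \<comment> \<open>With orbits 2 and 3 equal, \<open>F (t + 2)\<close> is
      \<open>c * P / 2\<close> and \<open>F (t + 5)\<close> is \<open>- c * P\<close>; the two
      expressions for \<open>F (t + 4)\<close> then give the quadratic.\<close>
    have "(2 * (c * c) + 3 * (s * c) - 2) * P = 0" using e e23 P by algebra
    then have "F 0 = 0" using quadratic_nonzero[OF tr(1)] tr(6,7) z1 s0 by (auto simp: P_def)
    then have "F t = 0" "F (t + 1) = 0" using F by simp_all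
    then have "F (t + 2) = 0" "F (t + 3) = 0" using e(1) e23 by simp_all
    then have "F (t + 4) = 0" "F (t + 5) = 0" using e(2,4) \<open>F (t + 1) = 0\<close> by simp_all
    show "F 0 = 0 \<and> (d < length (head1 (int m)) \<longrightarrow> F (Suc t + d) = 0)"
      using five[of d] \<open>F 0 = 0\<close> \<open>F (t + 1) = 0\<close> \<open>F (t + 2) = 0\<close> \<open>F (t + 3) = 0\<close> \<open>F (t + 4) = 0\<close> \<open>F (t + 5) = 0\<close>
      by (auto simp: eval_nat_numeral)
  next
    fix F d
    assume F: "F t = F 0 * of_real (y t)" "F (Suc t) = F 0 * of_real (y (Suc t))" and d: "d < length (head1 (int m))"
      and sys: "\<And>d. d < length (head1 (int m)) \<Longrightarrow> (\<Sum>(k, a)\<leftarrow>head1 (int m) ! d. of_real (- 1) powi a * F (t + k)) = (0::complex)"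
    have e: "F t + F (t + 2) + F (t + 3) = 0" "F (t + 1) - F (t + 2) + F (t + 4) = 0"
      "F (t + 1) - F (t + 3) + F (t + 4) = 0" "F (t + 2) + F (t + 3) + F (t + 5) = 0" "F (t + 4) + 2 * F (t + 5) = 0"
      using sys[of 0] sys[of 1] sys[of 2] sys[of 3] sys[of 4] m(2)
      by (simp_all add: head1_def algebra_simps)
    have e23: "F (t + 3) = F (t + 2)" using e(2,3) by (simp add: algebra_simps)
    have "F (t + 2) = - F t / 2" using e(1) unfolding e23 by (simp add: field_simps eq_neg_iff_add_eq_0)
    moreover have "F (t + 4) = F (t + 2) - F (t + 1)" using e(2) by (simp add: algebra_simps eq_neg_iff_add_eq_0)
    moreover have "F (t + 5) = - 2 * F (t + 2)" using e(4) unfolding e23 by (simp add: algebra_simps eq_neg_iff_add_eq_0)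
    ultimately show "F (Suc t + d) = F 0 * complex_of_real (y (Suc t + d))"
      using five[OF d] e23 F by (auto simp: eval_nat_numeral y)
  next
    fix d assume "d < length (head1 (int m))"
    from five[OF this] show "y (Suc t + d) \<noteq> 0" "(\<Sum>(k, a)\<leftarrow>head1 (int m) ! d. (- 1) powi a * y (t + k)) = 0"
      using m(2) by (auto simp: eval_nat_numeral y head1_def)
  qed (auto simp: t y_def)
qed


lemma nut_family2:
  assumes m: "3 \<le> m" "odd m" and t: "t = Suc (Suc (3 * k))"
  shows "nut_graph (voltage_graph (Suc t + length (head2 (int m))) (2 * m) (chain_darts m t (head2 (int m))))"
proof -
  define y :: "nat \<Rightarrow> real"
    \<comment> \<open>Again the solution at \<open>z = - 1\<close>, where each double edge
      contributes 2.\<close>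
    where "y i = (if i \<le> Suc t then tail_vector (- 1) 2 i
      else (- 1) ^ k * [3 / 2, 2, 1 / 2, - 1, - 1, 1 / 2, 1 / 2] ! (i - Suc (Suc t)))" for i
  have y: "y t = - 3 * (- 1) ^ k" "y (Suc t) = - ((- 1) ^ k)" "y (Suc (Suc t)) = 3 / 2 * (- 1) ^ k"
    "y (Suc (Suc (Suc t))) = 2 * (- 1) ^ k" "y (Suc (Suc (Suc (Suc t)))) = 1 / 2 * (- 1) ^ k"
    "y (Suc (Suc (Suc (Suc (Suc t))))) = - ((- 1) ^ k)" "y (Suc (Suc (Suc (Suc (Suc (Suc t)))))) = - ((- 1) ^ k)"
    "y (Suc (Suc (Suc (Suc (Suc (Suc (Suc t))))))) = 1 / 2 * (- 1) ^ k"
    "y (Suc (Suc (Suc (Suc (Suc (Suc (Suc (Suc t)))))))) = 1 / 2 * (- 1) ^ k"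
    using tail_vector_values[of "- 1 :: real" 2 k] by (simp_all add: y_def t del: tail_vector.simps(3))
  have eight: "d = 0 \<or> d = 1 \<or> d = 2 \<or> d = 3 \<or> d = 4 \<or> d = 5 \<or> d = 6 \<or> d = 7" if "d < length (head2 (int m))" for d
    using that by (auto simp: head2_def)
  show ?thesis
  proof (rule chain_nut_graph[OF m _ valid_heads(3)[OF m], where \<epsilon> = "- 1" and y = y])
    fix z F s c d
    assume z: "z ^ (2 * m) = 1" and s: "s = z ^ m" and c: "c = z powi 2 + z powi (- 2)" and z1: "z \<noteq> of_real (- 1)"
      and F: "F t = tail_vector s c t * F 0" "F (Suc t) = tail_vector s c (Suc t) * F 0"
      and sys: "\<And>d. d < length (head2 (int m)) \<Longrightarrow> (\<Sum>(k, a)\<leftarrow>head2 (int m) ! d. z powi a * F (t + k)) = (0::complex)"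
    note tr = root_of_unity_trace[OF z m(2) s c]
    define f g where "f = 1 + z powi 4" and "g = 1 + z powi (- 4)"
    have fg: "f * g = c * c" "f \<noteq> 0" "g \<noteq> 0" using tr(2,3,4) by (auto simp: f_def g_def)
    have e: "F t + f * F (t + 2) = 0" "g * F (t + 1) + F (t + 3) = 0" "F (t + 2) + s * F (t + 3) + F (t + 4) = 0"
      "F (t + 3) + f * F (t + 5) = 0" "g * F (t + 4) + F (t + 6) = 0" "F (t + 5) + F (t + 7) + F (t + 8) = 0"
      "F (t + 6) + c * F (t + 7) = 0" "F (t + 6) + c * F (t + 8) = 0"
      using sys[of 0] sys[of 1] sys[of 2] sys[of 3] sys[of 4] sys[of 5] sys[of 6] sys[of 7]
      by (simp_all add: head2_def s c f_def g_def algebra_simps)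
    have s0: "s \<noteq> 0" using tr(1) by auto
    define P where "P = s ^ k * F 0"
    have P: "F t = (s * c - 1) * P" "F (t + 1) = s * P"
      using F unfolding t tail_vector_values[OF tr(1)] by (simp_all add: P_def)
    \<comment> \<open>The head is eliminated from both ends towards the semi-edge at orbit 3; the
      nonzero factors \<open>c\<close> and \<open>g\<close> picked up on the way are cancelled
      before the quadratic appears.\<close>
    have a1: "c * c * F (t + 2) = - (g * F t)" using e(1) fg(1) by algebra
    have a3: "c * F (t + 5) = 2 * F (t + 6)" using e(6,7,8) by algebra
    have "c * F (t + 3) = c * (2 * c * F (t + 4))" using a3 e(4,5) fg(1) by algebra
    then have a4: "F (t + 3) = 2 * c * F (t + 4)" using tr(2) by simp
    have "g * (2 * F t + 2 * s * c * c * F (t + 1) + c * F (t + 1)) = 0" using a1 a4 e(2,3) by algebra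
    then have "2 * F t + 2 * s * c * c * F (t + 1) + c * F (t + 1) = 0" using fg(3) by simp
    then have "(2 * (c * c) + 3 * (s * c) - 2) * P = 0" using P tr(1) by algebra
    then have F0: "F 0 = 0" using quadratic_nonzero[OF tr(1)] tr(6,7) z1 s0 by (auto simp: P_def)
    then have t0: "F t = 0" and t1: "F (t + 1) = 0" using F by simp_all
    have t2: "F (t + 2) = 0" using e(1) t0 fg(2) by simp
    have t3: "F (t + 3) = 0" using e(2) t1 by simp
    have t4: "F (t + 4) = 0" using e(3) t2 t3 by simp
    have t5: "F (t + 5) = 0" using e(4) t3 fg(2) by simp
    have t6: "F (t + 6) = 0" using e(5) t4 by simp
    have t7: "F (t + 7) = 0" "F (t + 8) = 0" using e(7,8) t6 tr(2) by simp_all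
    show "F 0 = 0 \<and> (d < length (head2 (int m)) \<longrightarrow> F (Suc t + d) = 0)"
      using eight[of d] F0 t1 t2 t3 t4 t5 t6 t7 by (auto simp: eval_nat_numeral)
  next
    fix F d
    assume F: "F t = F 0 * of_real (y t)" "F (Suc t) = F 0 * of_real (y (Suc t))" and d: "d < length (head2 (int m))"
      and sys: "\<And>d. d < length (head2 (int m)) \<Longrightarrow> (\<Sum>(k, a)\<leftarrow>head2 (int m) ! d. of_real (- 1) powi a * F (t + k)) = (0::complex)"
    have e: "F t + 2 * F (t + 2) = 0" "2 * F (t + 1) + F (t + 3) = 0" "F (t + 2) - F (t + 3) + F (t + 4) = 0"
      "F (t + 3) + 2 * F (t + 5) = 0" "2 * F (t + 4) + F (t + 6) = 0"
      "F (t + 6) + 2 * F (t + 7) = 0" "F (t + 6) + 2 * F (t + 8) = 0"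
      using sys[of 0] sys[of 1] sys[of 2] sys[of 3] sys[of 4] sys[of 6] sys[of 7] m(2)
      by (simp_all add: head2_def algebra_simps)
    have b: "F (t + 2) = - F t / 2" "F (t + 3) = - 2 * F (t + 1)" "F (t + 4) = F (t + 3) - F (t + 2)"
      "F (t + 5) = - F (t + 3) / 2" "F (t + 6) = - 2 * F (t + 4)" "F (t + 7) = - F (t + 6) / 2" "F (t + 8) = - F (t + 6) / 2"
      using e by (simp_all add: field_simps eq_neg_iff_add_eq_0)
    define Q where "Q = F 0 * (- 1) ^ k"
    have q: "F t = - 3 * Q" "F (t + 1) = - Q" using F by (simp_all add: y Q_def)
    have q2: "F (t + 2) = 3 / 2 * Q" "F (t + 3) = 2 * Q" using b(1,2) q by simp_all
    then have q4: "F (t + 4) = 1 / 2 * Q" "F (t + 5) = - Q" using b(3,4) by simp_all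
    have q6: "F (t + 6) = - Q" unfolding b(5) q4(1) by simp
    have q7: "F (t + 7) = 1 / 2 * Q" "F (t + 8) = 1 / 2 * Q" unfolding b(6,7) q6 by simp_all
    show "F (Suc t + d) = F 0 * complex_of_real (y (Suc t + d))"
      using eight[OF d] q q2 q4 q6 q7 by (auto simp: eval_nat_numeral y Q_def)
  next
    fix d assume "d < length (head2 (int m))"
    from eight[OF this] show "y (Suc t + d) \<noteq> 0" "(\<Sum>(k, a)\<leftarrow>head2 (int m) ! d. (- 1) powi a * y (t + k)) = 0"
      using m(2) by (auto simp: eval_nat_numeral y head2_def)
  qed (auto simp: t y_def)
qed

section \<open>Infinitely many orders\<close>

lemma digraph_iso_card_verts:
  assumes "digraph_iso (with_proj G) (with_proj H)"
  shows "card (pverts G) = card (pverts H)"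
proof -
  obtain f where f: "pre_digraph.digraph_isomorphism (with_proj G) f" "with_proj H = app_iso f (with_proj G)"
    using assms by (auto simp: digraph_iso_def)
  have "pverts H = iso_verts f ` pverts G"
    using arg_cong[OF f(2), of verts] by (simp add: verts_app_iso)
  moreover have "inj_on (iso_verts f) (pverts G)"
    using f(1) by (simp add: pre_digraph.digraph_isomorphism_def)
  ultimately show ?thesis by (simp add: card_image)
qed

text \<open>Letting \<open>m\<close> run through the odd numbers \<open>2 * j + 3\<close> gives
  graphs with pairwise different numbers of vertices, hence pairwise non-isomorphic ones.\<close>

lemma infinite_chain_family:
  assumes t: "1 \<le> t" and l: "\<And>m. l = Suc t + length (hs m)"
    and valid: "\<And>m. 3 \<le> m \<Longrightarrow> odd m \<Longrightarrow> valid_head (2 * int m) (hs m)"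
    and nut: "\<And>m. 3 \<le> m \<Longrightarrow> odd m \<Longrightarrow>
      nut_graph (voltage_graph (Suc t + length (hs m)) (2 * m) (chain_darts m t (hs m)))"
  shows "\<exists>S :: nat pair_pre_digraph set. infinite S \<and>
    (\<forall>G\<in>S. nut_graph G \<and> cubic G \<and> circulant l G) \<and>
    (\<forall>G\<in>S. \<forall>H\<in>S. G \<noteq> H \<longrightarrow> \<not> digraph_iso (with_proj G) (with_proj H))"
proof -
  define \<G> where "\<G> j = voltage_graph l (2 * (2 * j + 3)) (chain_darts (2 * j + 3) t (hs (2 * j + 3)))" for j
  have card: "card (pverts (\<G> j)) = l * (2 * (2 * j + 3))" for j
    by (simp add: \<G>_def voltage_graph_def)
  have "l \<noteq> 0" using l[of 0] by simp
  then have inj: "i = j" if "card (pverts (\<G> i)) = card (pverts (\<G> j))" for i j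
    using that unfolding card by simp
  have "nut_graph (\<G> j) \<and> cubic (\<G> j) \<and> circulant l (\<G> j)" for j
  proof -
    have m: "3 \<le> 2 * j + 3" "odd (2 * j + 3)" by simp_all
    interpret cubic_voltage l "2 * (2 * j + 3)" "chain_darts (2 * j + 3) t (hs (2 * j + 3))"
      using chain_cubic_voltage[OF m t valid[OF m]] l[of "2 * j + 3"] by simp
    show ?thesis using nut[OF m] cubic circulant l[of "2 * j + 3"] by (simp add: \<G>_def)
  qed
  moreover have "infinite (range \<G>)"
    using inj by (intro range_inj_infinite injI) metis
  moreover have "\<not> digraph_iso (with_proj (\<G> i)) (with_proj (\<G> j))" if "\<G> i \<noteq> \<G> j" for i j
    using digraph_iso_card_verts inj that by metis
  ultimately show ?thesis by (intro exI[of _ "range \<G>"]) auto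
qed

theorem theorem2:
  fixes l :: nat
  assumes "l \<ge> 1"
  shows "(l \<in> {1, 2, 4, 5} \<longrightarrow>
            \<not> (\<exists>G :: 'a pair_pre_digraph. nut_graph G \<and> cubic G \<and> circulant l G)) \<and>
         (l \<in> {3, 6, 7} \<or> l \<ge> 9 \<longrightarrow>
            (\<exists>S :: nat pair_pre_digraph set.
               infinite S \<and>
               (\<forall>G\<in>S. nut_graph G \<and> cubic G \<and> circulant l G) \<and>
               (\<forall>G\<in>S. \<forall>H\<in>S. G \<noteq> H \<longrightarrow> \<not> digraph_iso (with_proj G) (with_proj H))))"
proof (intro conjI impI)
  assume "l \<in> {1, 2, 4, 5}"
  then have "refuted l" using refuted by auto
  then show "\<not> (\<exists>G :: 'a pair_pre_digraph. nut_graph G \<and> cubic G \<and> circulant l G)"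
    using cubic_circulant_nut_not_refuted by blast
next
  assume "l \<in> {3, 6, 7} \<or> l \<ge> 9"
  \<comment> \<open>One family per residue class modulo 3, with least members 3, 7 and 11; in the
    last class 8 is outside the hypothesis.\<close>
  then have "(\<exists>k. l = 3 * k + 3) \<or> (\<exists>k. l = 3 * k + 7) \<or> (\<exists>k. l = 3 * k + 11)"
    unfolding insert_iff empty_iff by presburger
  then consider k where "l = 3 * k + 3" | k where "l = 3 * k + 7" | k where "l = 3 * k + 11" by blast
  then show "\<exists>S :: nat pair_pre_digraph set. infinite S \<and>
      (\<forall>G\<in>S. nut_graph G \<and> cubic G \<and> circulant l G) \<and>
      (\<forall>G\<in>S. \<forall>H\<in>S. G \<noteq> H \<longrightarrow> \<not> digraph_iso (with_proj G) (with_proj H))"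
  proof cases
    case 1
    show ?thesis
    proof (rule infinite_chain_family[of "Suc (3 * k)" l "\<lambda>_. head0"])
      show "l = Suc (Suc (3 * k)) + length head0" by (simp add: 1 head0_def)
    qed (simp, (rule valid_heads nut_family0[OF _ _ refl]; assumption)+)
  next
    case 2
    show ?thesis
    proof (rule infinite_chain_family[of "Suc (3 * k)" l "\<lambda>m. head1 (int m)"])
      show "l = Suc (Suc (3 * k)) + length (head1 (int m))" for m by (simp add: 2 head1_def)
    qed (simp, (rule valid_heads nut_family1[OF _ _ refl]; assumption)+)
  next
    case 3
    show ?thesis
    proof (rule infinite_chain_family[of "Suc (Suc (3 * k))" l "\<lambda>m. head2 (int m)"])
      show "l = Suc (Suc (Suc (3 * k))) + length (head2 (int m))" for m by (simp add: 3 head2_def)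
    qed (simp, (rule valid_heads nut_family2[OF _ _ refl]; assumption)+)
  qed
qed

end
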